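(* Let $\Phi=\{\phi_\ell(x)=Ax+a_\ell\}_{\ell=1}^m$ be an affinely irreducible generalized Pisot IFS on $\mathbb{R}^d$. Then there exists a strictly positive probability vector $\boldsymbol{p}=(p_\ell)_{\ell=1}^m$ such that the self-affine measure associated with $\Phi$ and $\boldsymbol{p}$ is non-Rajchman.
   Context: A homogeneous affine IFS on $\mathbb{R}^d$ ($d\ge 1$) is a finite family $\Phi=\{\phi_\ell(x)=Ax+a_\ell\}_{\ell=1}^m$ with $A\in GL_d(\mathbb{R})$ of spectral radius less than $1$ and $a_\ell\in\mathbb{R}^d$. It is affinely irreducible if there is no proper affine subspace $V$ of $\mathbb{R}^d$ with $\phi_\ell(V)=V$ for all $1\le \ell\le m$. For a probability vector $\boldsymbol{p}=(p_\ell)_{\ell=1}^m$, the associated self-affine measure is the unique Borel probability measure $\mu$ on $\mathbb{R}^d$ with $\mu=\sum_{\ell=1}^m p_\ell\,\mu\circ\phi_\ell^{-1}$. The Fourier transform of a Borel probability measure $\nu$ on $\mathbb{R}^d$ is $\widehat\nu(\xi)=\int e^{2\pi i\langle \xi,x\rangle}\,d\nu(x)$; $\nu$ is Rajchman if $|\widehat\nu(\xi)|\to0$ as $|\xi|\to\infty$, and non-Rajchman otherwise. On $\mathbb{C}^d$, $\langle z,w\rangle=\sum_j z_j\overline{w_j}$. Pisot tuple: a finite collection $\{\beta_1,\dots,\beta_k\}$ of distinct algebraic integers (real or complex) such that (i) $|\beta_j|>1$ for all $j$; (ii) there is a monic $P\in\mathbb{Z}[x]$ with $P(\beta_j)=0$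 for all $1\le j\le k$ such that every other root $z$ of $P$, if any, satisfies $|z|<1$. Generalized Pisot IFS: a homogeneous affine IFS $\{Ax+a_\ell\}_{\ell=1}^m$ on $\mathbb{R}^d$ for which there exist $k\ge1$, $\beta_1,\dots,\beta_k\in\mathbb{C}$ and $\zeta_1,\dots,\zeta_k\in\mathbb{C}^d\setminus\{0\}$ such that: (i) $\{\beta_1,\dots,\beta_k\}$ is a Pisot tuple; (ii) $A^{\top}\zeta_j=\beta_j^{-1}\zeta_j$ for $1\le j\le k$; (iii) for every $1\le\ell\le m$ there is $P_\ell\in\mathbb{Z}[x]$ with $\langle\zeta_j,a_\ell-a_1\rangle=P_\ell(\beta_j)$ for all $1\le j\le k$. *)

theory Defs
  imports
    "HOL-Probability.Probability"
    "HOL-Computational_Algebra.Polynomial"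
begin

text \<open>
  A homogeneous affine IFS with \<open>m\<close> maps is given by its linear part \<open>A\<close> and its translations
  \<open>a 1, \<dots>, a m\<close>; values of \<open>a\<close> (and of probability vectors) outside \<open>{1..m}\<close> are irrelevant.
\<close>

definition complex_vec :: "real ^ 'd \<Rightarrow> complex ^ 'd" where
  "complex_vec x = (\<chi> i. complex_of_real (x $ i))"

definition complex_mat :: "real ^ 'd ^ 'd \<Rightarrow> complex ^ 'd ^ 'd" where
  "complex_mat A = (\<chi> i j. complex_of_real (A $ i $ j))"

text \<open>The library inner product on \<^typ>\<open>complex ^ 'd\<close> is real-valued, hence this one.\<close>

definition hermitian_inner :: "complex ^ 'd \<Rightarrow> complex ^ 'd \<Rightarrow> complex" where
  "hermitian_inner z w = (\<Sum>j\<in>UNIV. z $ j * cnj (w $ j))"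

definition complex_eigenvalues :: "real ^ 'd ^ 'd \<Rightarrow> complex set" where
  "complex_eigenvalues A = {c. \<exists>v. v \<noteq> 0 \<and> complex_mat A *v v = c *s v}"

definition real_mat_spectral_radius :: "real ^ 'd ^ 'd \<Rightarrow> real" where
  "real_mat_spectral_radius A = Max (cmod ` complex_eigenvalues A)"

definition ifs_map :: "real ^ 'd ^ 'd \<Rightarrow> (nat \<Rightarrow> real ^ 'd) \<Rightarrow> nat \<Rightarrow> real ^ 'd \<Rightarrow> real ^ 'd" where
  "ifs_map A a l x = A *v x + a l"

definition homogeneous_affine_ifs :: "nat \<Rightarrow> real ^ 'd ^ 'd \<Rightarrow> (nat \<Rightarrow> real ^ 'd) \<Rightarrow> bool" where
  "homogeneous_affine_ifs m A a \<longleftrightarrow>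
     1 \<le> m \<and> invertible A \<and> real_mat_spectral_radius A < 1"

text \<open>
  \<^const>\<open>affine\<close> holds of the empty set, which is excluded here; singletons do count
  as affine subspaces.
\<close>

definition affinely_irreducible :: "nat \<Rightarrow> real ^ 'd ^ 'd \<Rightarrow> (nat \<Rightarrow> real ^ 'd) \<Rightarrow> bool" where
  "affinely_irreducible m A a \<longleftrightarrow>
     \<not> (\<exists>V. affine V \<and> V \<noteq> {} \<and> V \<noteq> UNIV \<and> (\<forall>l\<in>{1..m}. ifs_map A a l ` V = V))"

definition pisot_tuple :: "nat \<Rightarrow> (nat \<Rightarrow> complex) \<Rightarrow> bool" where
  "pisot_tuple k \<beta> \<longleftrightarrow>
     inj_on \<beta> {1..k} \<and>
     (\<forall>j\<in>{1..k}. algebraic_int (\<beta> j)) \<and>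
     (\<forall>j\<in>{1..k}. cmod (\<beta> j) > 1) \<and>
     (\<exists>P :: int poly. lead_coeff P = 1 \<and>
        (\<forall>j\<in>{1..k}. poly (map_poly of_int P) (\<beta> j) = 0) \<and>
        (\<forall>z. poly (map_poly of_int P) z = 0 \<and> z \<notin> \<beta> ` {1..k} \<longrightarrow> cmod z < 1))"

definition generalized_pisot_ifs :: "nat \<Rightarrow> real ^ 'd ^ 'd \<Rightarrow> (nat \<Rightarrow> real ^ 'd) \<Rightarrow> bool" where
  "generalized_pisot_ifs m A a \<longleftrightarrow>
     homogeneous_affine_ifs m A a \<and>
     (\<exists>(k :: nat) (\<beta> :: nat \<Rightarrow> complex) (\<zeta> :: nat \<Rightarrow> complex ^ 'd).
        1 \<le> k \<and>
        (\<forall>j\<in>{1..k}. \<zeta> j \<noteq> 0) \<and>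
        pisot_tuple k \<beta> \<and>
        (\<forall>j\<in>{1..k}. complex_mat (transpose A) *v \<zeta> j = inverse (\<beta> j) *s \<zeta> j) \<and>
        (\<forall>l\<in>{1..m}. \<exists>P :: int poly. \<forall>j\<in>{1..k}.
           hermitian_inner (\<zeta> j) (complex_vec (a l - a 1)) = poly (map_poly of_int P) (\<beta> j)))"

definition probability_vector :: "nat \<Rightarrow> (nat \<Rightarrow> real) \<Rightarrow> bool" where
  "probability_vector m p \<longleftrightarrow> (\<forall>l\<in>{1..m}. 0 \<le> p l) \<and> (\<Sum>l=1..m. p l) = 1"

definition borel_probability_measure :: "(real ^ 'd) measure \<Rightarrow> bool" where
  "borel_probability_measure \<nu> \<longleftrightarrow> prob_space \<nu> \<and> sets \<nu> = sets borel"

definition self_affine_measure ::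
  "nat \<Rightarrow> real ^ 'd ^ 'd \<Rightarrow> (nat \<Rightarrow> real ^ 'd) \<Rightarrow> (nat \<Rightarrow> real) \<Rightarrow> (real ^ 'd) measure" where
  "self_affine_measure m A a p = (THE \<mu>. borel_probability_measure \<mu> \<and>
     (\<forall>B\<in>sets borel. measure \<mu> B = (\<Sum>l=1..m. p l * measure (distr \<mu> borel (ifs_map A a l)) B)))"

definition fourier_transform :: "(real ^ 'd) measure \<Rightarrow> real ^ 'd \<Rightarrow> complex" where
  "fourier_transform \<nu> \<xi> = (LINT x|\<nu>. exp (2 * complex_of_real pi * \<i> * complex_of_real (\<xi> \<bullet> x)))"

definition rajchman :: "(real ^ 'd) measure \<Rightarrow> bool" where
  "rajchman \<nu> \<longleftrightarrow> ((\<lambda>\<xi>. cmod (fourier_transform \<nu> \<xi>)) \<longlongrightarrow> 0) at_infinity"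

end

theory Submission
  imports Defs "HOL-Computational_Algebra.Fundamental_Theorem_Algebra"
begin

text \<open>
  Let \<open>P\<close> be the polynomial of the Pisot tuple, \<open>S\<close> its roots of modulus greater than 1, and
  \<open>\<xi>\<^sub>n = Re (\<Sum>z\<in>S. mult(z) z\<^sup>n \<zeta>\<^sub>z)\<close>. Then \<open>A\<^sup>\<top> \<xi>\<^sub>n\<^sub>+\<^sub>1 = \<xi>\<^sub>n\<close>, and \<open>\<langle>\<xi>\<^sub>n, a\<^sub>l - a\<^sub>1\<rangle>\<close> is within a
  geometrically small error of an integer, because the same sum over all roots of \<open>P\<close>, with
  \<open>\<langle>\<zeta>\<^sub>z, a\<^sub>l - a\<^sub>1\<rangle> = P\<^sub>l(z)\<close>, is an integer and the other roots lie inside the unit disc.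
  Irreducibility is used for \<open>\<xi>\<^sub>0 \<noteq> 0\<close>, which forces \<open>\<bar>\<xi>\<^sub>n\<bar> \<rightarrow> \<infinity>\<close>. By self-affinity,
  \<open>\<bar>\<mu>^(\<xi>\<^sub>n\<^sub>+\<^sub>1)\<bar> = \<bar>\<Sum>l. p\<^sub>l e(\<langle>\<xi>\<^sub>n\<^sub>+\<^sub>1, a\<^sub>l - a\<^sub>1\<rangle>)\<bar> \<bar>\<mu>^(\<xi>\<^sub>n)\<bar>\<close>, where the first factor is
  \<open>1 - O(\<epsilon>\<^sub>n)\<close> with summable \<open>\<epsilon>\<^sub>n\<close>; and if \<open>p\<^sub>1 > 1/2\<close> that factor never vanishes, so neither
  does \<open>\<mu>^\<close>. Hence \<open>\<mu>^(\<xi>\<^sub>n)\<close> stays away from 0.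
\<close>

section \<open>Iterates of a matrix\<close>

text \<open>This is the vector \<open>q(B) v\<close>, evaluated by Horner's scheme; only the action
  on vectors is needed, so the matrix \<open>q(B)\<close> itself is never formed.\<close>

definition mat_poly :: "'a::field ^ 'n ^ 'n \<Rightarrow> 'a poly \<Rightarrow> 'a ^ 'n \<Rightarrow> 'a ^ 'n" where
  "mat_poly B q v = fold_coeffs (\<lambda>c w. c *s v + B *v w) q 0"

lemma mat_poly_0 [simp]: "mat_poly B 0 v = 0"
  by (simp add: mat_poly_def)

lemma mat_poly_pCons [simp]: "mat_poly B (pCons c q) v = c *s v + B *v mat_poly B q v"
proof (cases "c = 0 \<and> q = 0")
  case False
  then have "fold_coeffs (\<lambda>c w. c *s v + B *v w) (pCons c q)
      = (\<lambda>w. c *s v + B *v w) \<circ> fold_coeffs (\<lambda>c w. c *s v + B *v w) q"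
    by (cases "q = 0") auto
  then show ?thesis by (simp add: mat_poly_def)
qed auto

lemma mat_poly_add: "mat_poly B (p + q) v = mat_poly B p v + mat_poly B q v"
  by (induction p q rule: poly_induct2)
     (simp_all add: vec.scale_left_distrib matrix_vector_right_distrib ac_simps)

lemma mat_poly_smult: "mat_poly B (smult c q) v = c *s mat_poly B q v"
  by (induction q) (simp_all add: vec.scale_right_distrib vector_scalar_commute)

lemma mat_poly_mult: "mat_poly B (p * q) v = mat_poly B p (mat_poly B q v)"
  by (induction p) (simp_all add: mat_poly_add mat_poly_smult)

lemma mat_poly_monom: "mat_poly B (monom 1 n) v = (((*v) B) ^^ n) v"
  by (induction n) (simp_all add: monom_0 monom_Suc)

lemma mat_poly_eigen:
  assumes "B *v v = c *s v"
  shows "mat_poly B q v = poly q c *s v"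
  by (induction q)
     (simp_all add: vector_scalar_commute assms vec.scale_left_distrib mult.commute)

lemma mat_poly_vec_add: "mat_poly B q (u + v) = mat_poly B q u + mat_poly B q v"
  by (induction q) (simp_all add: vec.scale_right_distrib matrix_vector_right_distrib ac_simps)

lemma mat_poly_vec_scale: "mat_poly B q (c *s v) = c *s mat_poly B q v"
  by (induction q)
     (simp_all add: vec.scale_right_distrib vector_scalar_commute mult.commute)

lemma mat_poly_vec_0: "mat_poly B q 0 = 0"
  using mat_poly_vec_scale[of B q 0 0] by simp

text \<open>In finite dimension some iterate \<open>B^n v\<close> lies in the span of the earlier
  ones, and this dependence is a monic polynomial killing \<open>v\<close>. An annihilator depending
  on \<open>v\<close> is enough below and replaces the Cayley-Hamilton theorem.\<close>

lemma annihilating_poly_exists: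
  fixes B :: "'a::field ^ 'n ^ 'n"
  shows "\<exists>q. q \<noteq> 0 \<and> mat_poly B q v = 0"
proof -
  define f where "f n = (((*v) B) ^^ n) v" for n
  have "\<exists>n. f n \<in> vec.span (f ` {..<n})"
  proof (rule ccontr)
    assume "\<nexists>n. f n \<in> vec.span (f ` {..<n})"
    then have *: "f n \<notin> vec.span (f ` {..<n})" for n by auto
    have "vec.independent (f ` {..<n}) \<and> card (f ` {..<n}) = n" for n
    proof (induction n)
      case (Suc n)
      have "f n \<notin> f ` {..<n}"
        using *[of n] by (rule contrapos_nn) (rule vec.span_base)
      moreover have "vec.independent (insert (f n) (f ` {..<n}))"
        by (rule vec.independent_insertI[OF * conjunct1[OF Suc]])
      ultimately show ?case using Suc by (simp add: lessThan_Suc)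
    qed (simp add: vec.independent_empty)
    from this[of "Suc (CARD('n))"] have
      "vec.independent (f ` {..<Suc (CARD('n))})" "card (f ` {..<Suc (CARD('n))}) = Suc (CARD('n))"
      by auto
    moreover have "vec.dim (UNIV :: ('a ^ 'n) set) = CARD('n)"
      by (rule vec_dim_card)
    ultimately show False
      using vec.independent_card_le_dim[of "f ` {..<Suc (CARD('n))}" UNIV] by simp
  qed
  then obtain n where n: "f n \<in> vec.span (f ` {..<n})" by auto
  define W where "W = {mat_poly B q v |q. \<forall>i\<ge>n. coeff q i = 0}"
  have "vec.subspace W"
  proof (rule vec.subspaceI)
    show "0 \<in> W" unfolding W_def by (auto intro!: exI[of _ 0])
    show "x + y \<in> W" if "x \<in> W" "y \<in> W" for x y
    proof -
      from that obtain p q where "x = mat_poly B p v" "y = mat_poly B q v"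
        "\<forall>i\<ge>n. coeff p i = 0" "\<forall>i\<ge>n. coeff q i = 0" unfolding W_def by auto
      then show ?thesis unfolding W_def by (auto intro!: exI[of _ "p + q"] simp: mat_poly_add)
    qed
    show "c *s x \<in> W" if "x \<in> W" for x c
    proof -
      from that obtain p where "x = mat_poly B p v"
        "\<forall>i\<ge>n. coeff p i = 0" unfolding W_def by auto
      then show ?thesis unfolding W_def by (auto intro!: exI[of _ "smult c p"] simp: mat_poly_smult)
    qed
  qed
  moreover have "f ` {..<n} \<subseteq> W"
  proof
    fix x assume "x \<in> f ` {..<n}"
    then obtain i where "i < n" "x = f i" by auto
    then show "x \<in> W" unfolding W_def f_def
      by (auto intro!: exI[of _ "monom 1 i"] simp: mat_poly_monom)
  qed
  ultimately have "f n \<in> W" using n vec.span_minimal[of "f ` {..<n}" W] by auto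
  then obtain q where q: "f n = mat_poly B q v" "\<forall>i\<ge>n. coeff q i = 0" unfolding W_def by auto
  have "coeff (monom 1 n + smult (-1) q) n = 1" using q by simp
  then have "monom 1 n + smult (-1) q \<noteq> 0" by force
  moreover have "mat_poly B (monom 1 n + smult (-1) q) v = 0"
    unfolding mat_poly_add mat_poly_smult mat_poly_monom q(1)[unfolded f_def] by simp
  ultimately show ?thesis by blast
qed

text \<open>A product of annihilators of the basis vectors kills every vector, so all eigenvalues
  are roots of one nonzero polynomial. Finiteness makes the \<open>Max\<close> in
  \<open>real_mat_spectral_radius\<close> a genuine upper bound.\<close>

lemma finite_eigenvalues:
  fixes B :: "'a::field ^ 'n ^ 'n"
  shows "finite {c. \<exists>v. v \<noteq> 0 \<and> B *v v = c *s v}"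
proof -
  have "\<exists>q. q \<noteq> 0 \<and> (\<forall>v\<in>S. mat_poly B q v = 0)" if "finite S" for S
    using that
  proof (induction S)
    case (insert v S)
    then obtain q where q: "q \<noteq> 0" "\<forall>v\<in>S. mat_poly B q v = 0" by auto
    obtain p where p: "p \<noteq> 0" "mat_poly B p v = 0" using annihilating_poly_exists by blast
    have "mat_poly B (p * q) v = 0"
      using p by (subst mult.commute, subst mat_poly_mult) (simp add: mat_poly_vec_0)
    moreover have "\<forall>v\<in>S. mat_poly B (p * q) v = 0"
      using q by (simp add: mat_poly_mult mat_poly_vec_0)
    ultimately show ?case using p q by (intro exI[of _ "p * q"]) auto
  qed (auto intro!: exI[of _ 1])
  from this[of "range (\<lambda>i. axis i 1)"]
  obtain q where q: "q \<noteq> 0" "\<And>i. mat_poly B q (axis i 1) = 0" by auto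
  have "mat_poly B q v = 0" for v
  proof -
    have "vec.subspace {v. mat_poly B q v = 0}"
      by (rule vec.subspaceI) (auto simp: mat_poly_vec_add mat_poly_vec_scale mat_poly_vec_0)
    moreover have "cart_basis \<subseteq> {v. mat_poly B q v = 0}"
      using q by (auto simp: cart_basis_def)
    ultimately have "vec.span cart_basis \<subseteq> {v. mat_poly B q v = 0}"
      by (rule vec.span_minimal[rotated])
    then show ?thesis using span_cart_basis by auto
  qed
  then have "{c. \<exists>v. v \<noteq> 0 \<and> B *v v = c *s v} \<subseteq> {c. poly q c = 0}"
    using mat_poly_eigen[of B _ _ q] by fastforce
  then show ?thesis using poly_roots_finite[OF q(1)] finite_subset by blast
qed

section \<open>Summability of orbits\<close>

lemma summable_linear_recurrence_le:
  fixes x y :: "nat \<Rightarrow> real"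
  assumes "\<And>n. 0 \<le> x n" "\<And>n. x (Suc n) \<le> r * x n + y n" "0 \<le> r" "r < 1"
    "\<And>n. 0 \<le> y n" "summable y"
  shows "summable x"
proof (rule summableI_nonneg_bounded)
  show "0 \<le> x n" for n by fact
  \<comment> \<open>The bound is the fixed point of
    \<open>s \<mapsto> x 0 + r * s + suminf y\<close>, the map that controls each partial sum by the
    previous one.\<close>
  show "sum x {..<n} \<le> (x 0 + suminf y) / (1 - r)" for n
  proof (induction n)
    case 0
    have "0 \<le> suminf y" using assms by (intro suminf_nonneg)
    then show ?case using assms(1)[of 0] assms(4) by simp
  next
    case (Suc n)
    have "sum x {..<Suc n} = x 0 + (\<Sum>i<n. x (Suc i))" by (rule sum.lessThan_Suc_shift)
    also have "\<dots> \<le> x 0 + (\<Sum>i<n. r * x i + y i)" by (intro add_left_mono sum_mono assms(2))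
    also have "\<dots> = x 0 + (r * sum x {..<n} + sum y {..<n})"
      by (simp add: sum.distrib sum_distrib_left)
    also have "\<dots> \<le> x 0 + (r * ((x 0 + suminf y) / (1 - r)) + suminf y)"
      by (intro add_left_mono add_mono mult_left_mono Suc sum_le_suminf assms) auto
    also have "\<dots> = (x 0 + suminf y) / (1 - r)" using \<open>r < 1\<close> by (simp add: field_simps)
    finally show ?case .
  qed
qed

text \<open>Induction on the degree of an annihilator takes the place of a Jordan form. If a root
  \<open>z\<close> has modulus below 1, then \<open>w = (B - z) v\<close> has an annihilator of
  smaller degree, and the orbit of \<open>v\<close> obeys a contracting recurrence with the orbit of
  \<open>w\<close> as summable forcing. Otherwise \<open>z\<close> is no eigenvalue, so the
  remaining factor \<open>p\<close> alone already kills \<open>v\<close>.\<close>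

lemma summable_norm_iterates:
  fixes B :: "complex ^ 'n ^ 'n"
  assumes ev: "\<And>c v. v \<noteq> 0 \<Longrightarrow> B *v v = c *s v \<Longrightarrow> cmod c < 1"
  shows "summable (\<lambda>n. norm ((((*v) B) ^^ n) v))"
proof -
  have "summable (\<lambda>n. norm ((((*v) B) ^^ n) v))" if "q \<noteq> 0" "mat_poly B q v = 0" for q v
    using that
  proof (induction "degree q" arbitrary: q v rule: less_induct)
    case less
    show ?case
    proof (cases "degree q = 0")
      case True
      then obtain c where "q = [:c:]" using degree_eq_zeroE by blast
      with less have "v = 0" by auto
      moreover have "(((*v) B) ^^ n) 0 = 0" for n by (induction n) auto
      ultimately show ?thesis by simp
    next
      case False
      then obtain z where "poly q z = 0" using alg_closed_imp_poly_has_root by blast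
      then obtain p where p: "q = [:-z, 1:] * p" using poly_eq_0_iff_dvd by blast
      then have p0: "p \<noteq> 0" using less by auto
      have "degree q = 1 + degree p" unfolding p using p0 by (subst degree_mult_eq) auto
      then have deg: "degree p < degree q" by simp
      define w where "w = mat_poly B [:-z, 1:] v"
      have wv: "w = B *v v - z *s v" by (simp add: w_def)
      show ?thesis
      proof (cases "cmod z < 1")
        case True
        have "mat_poly B p w = 0" unfolding w_def mat_poly_mult[symmetric]
          using less p by (simp add: mult.commute)
        then have sw: "summable (\<lambda>n. norm ((((*v) B) ^^ n) w))" using less.hyps[OF deg p0] by simp
        have eq: "(((*v) B) ^^ Suc n) v = z *s (((*v) B) ^^ n) v + (((*v) B) ^^ n) w" for n
        proof (induction n)
          case (Suc n)
          have "(((*v) B) ^^ Suc (Suc n)) v = B *v (((*v) B) ^^ Suc n) v" by simp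
          also have "\<dots> = B *v (z *s (((*v) B) ^^ n) v + (((*v) B) ^^ n) w)" unfolding Suc ..
          finally show ?case by (simp add: matrix_vector_right_distrib vector_scalar_commute)
        qed (simp add: wv)
        have "norm (z *s u) = cmod z * norm u" for u :: "complex ^ 'n"
          by (simp add: norm_vec_def norm_mult L2_set_right_distrib)
        then have "norm ((((*v) B) ^^ Suc n) v)
          \<le> cmod z * norm ((((*v) B) ^^ n) v) + norm ((((*v) B) ^^ n) w)" for n
          unfolding eq by (metis norm_triangle_ineq)
        then show ?thesis
          using True by (intro summable_linear_recurrence_le[OF _ _ _ _ _ sw, of _ "cmod z"]) auto
      next
        case False
        define u where "u = mat_poly B p v"
        have "B *v u - z *s u = mat_poly B q v" unfolding p mat_poly_mult u_def by simp
        then have "B *v u = z *s u" using less by simp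
        then have "u = 0" using ev False by blast
        then show ?thesis using less.hyps[OF deg p0] u_def by simp
      qed
    qed
  qed
  then show ?thesis using annihilating_poly_exists by blast
qed

section \<open>Power sums over the roots of an integer polynomial\<close>

lemma monic_linear_prod:
  fixes M :: "'a::idom multiset"
  shows "lead_coeff (\<Prod>z\<in>#M. [:-z, 1:]) = 1 \<and> degree (\<Prod>z\<in>#M. [:-z, 1:]) = size M"
proof (induction M)
  case (add z M)
  define q where "q = (\<Prod>z\<in>#M. [:-z, 1:])"
  have q: "lead_coeff q = 1" "degree q = size M" using add by (auto simp: q_def)
  then have "q \<noteq> 0" by auto
  then have "degree ([:-z, 1:] * q) = Suc (size M)" using q(2) by (subst degree_mult_eq) auto
  moreover have "lead_coeff ([:-z, 1:] * q) = 1" unfolding lead_coeff_mult using q(1) by simp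
  ultimately show ?case by (simp del: mult_pCons_left add: q_def)
qed auto

lemma sum_mset_eq_sum_count:
  "(\<Sum>z\<in>#M. f z) = (\<Sum>z\<in>set_mset M. of_nat (count M z) * (f z :: 'b::comm_semiring_1))"
proof (induction M)
  case (add z M)
  have "(\<Sum>y\<in>set_mset (add_mset z M). of_nat (count (add_mset z M) y) * f y)
      = (\<Sum>y\<in>insert z (set_mset M). of_nat (count M y) * f y + (if y = z then f y else 0))"
    by (intro sum.cong) (auto simp: algebra_simps)
  also have "\<dots> = (\<Sum>y\<in>insert z (set_mset M). of_nat (count M y) * f y) + f z"
    by (subst sum.distrib) simp
  also have "(\<Sum>y\<in>insert z (set_mset M). of_nat (count M y) * f y)
      = (\<Sum>y\<in>set_mset M. of_nat (count M y) * f y)"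
    by (intro sum.mono_neutral_right) (auto simp: not_in_iff)
  finally show ?case using add by (simp add: add.commute)
qed simp

text \<open>Formally \<open>f * pderiv Q / Q\<close> is the sum of \<open>f / (x - z)\<close> over
  the roots, and each \<open>f / (x - z)\<close> is a polynomial plus \<open>f(z) / (x - z)\<close>;
  so the top coefficient of the remainder is the sum of the \<open>f(z)\<close>. Using
  \<open>pCons 0 R\<close> reads the coefficient of index \<open>size M - 1\<close> and gives 0 for
  the empty multiset.\<close>

lemma pderiv_linear_prod_decomp:
  fixes M :: "'a::{idom,ring_char_0} multiset"
  assumes "Q = (\<Prod>z\<in>#M. [:-z, 1:])"
  shows "\<exists>K R. f * pderiv Q = K * Q + R \<and> (\<forall>i\<ge>size M. coeff R i = 0) \<and>
           coeff (pCons 0 R) (size M) = (\<Sum>z\<in>#M. poly f z)"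
  using assms
proof (induction M arbitrary: Q)
  case empty
  then show ?case by (intro exI[of _ 0]) auto
next
  case (add z M)
  define Q' where "Q' = (\<Prod>z\<in>#M. [:-z, 1:])"
  obtain K R where IH: "f * pderiv Q' = K * Q' + R" "\<forall>i\<ge>size M. coeff R i = 0"
    "coeff (pCons 0 R) (size M) = (\<Sum>z\<in>#M. poly f z)"
    using add.IH[OF Q'_def] by blast
  have Q: "Q = [:-z, 1:] * Q'" using add.prems by (simp add: Q'_def)
  have "poly (f - [:poly f z:]) z = 0" by simp
  then obtain g where g: "f - [:poly f z:] = [:-z, 1:] * g"
    using poly_eq_0_iff_dvd by blast
  have lead: "lead_coeff Q' = 1" "degree Q' = size M"
    using monic_linear_prod[of M] by (auto simp: Q'_def)
  \<comment> \<open>The new root contributes \<open>poly f z\<close> times the monic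
    \<open>Q'\<close>, which adds exactly \<open>poly f z\<close> to the top coefficient.\<close>
  define R' where "R' = smult (poly f z) Q' + [:-z, 1:] * R"
  have fg: "f = [:-z, 1:] * g + [:poly f z:]" using g by (simp add: algebra_simps)
  have pd: "pderiv Q = Q' + [:-z, 1:] * pderiv Q'"
    unfolding Q by (simp only: pderiv_mult) (simp add: pderiv_pCons)
  have "f * pderiv Q = f * Q' + [:-z, 1:] * (f * pderiv Q')"
    unfolding pd by (simp only: ring_distribs mult.assoc mult.left_commute)
  also have "f * Q' = g * Q + smult (poly f z) Q'"
  proof -
    have "smult (poly f z) Q' = [:poly f z:] * Q'" by simp
    then show ?thesis unfolding Q by (subst fg) (simp only: ring_distribs mult_ac)
  qed
  also have "[:-z, 1:] * (f * pderiv Q') = K * Q + [:-z, 1:] * R"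
    unfolding IH Q by (simp only: ring_distribs mult.assoc mult.left_commute)
  finally have 1: "f * pderiv Q = (g + K) * Q + R'"
    unfolding R'_def by (simp only: ring_distribs add.assoc add.left_commute)
  have cR: "coeff R' i = poly f z * coeff Q' i + (coeff (pCons 0 R) i - z * coeff R i)" for i
    unfolding R'_def by simp
  have 2: "\<forall>i\<ge>size (add_mset z M). coeff R' i = 0"
  proof (intro allI impI)
    fix i assume i: "size (add_mset z M) \<le> i"
    then obtain j where "i = Suc j" "size M \<le> j" by (cases i) auto
    then show "coeff R' i = 0" using IH(2) lead(2) by (simp add: cR coeff_eq_0)
  qed
  have 3: "coeff (pCons 0 R') (size (add_mset z M)) = (\<Sum>z\<in>#add_mset z M. poly f z)"
    using IH(2,3) lead by (simp add: cR)
  show ?case using 1 2 3 by blast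
qed

section \<open>Integer polynomials and their complex roots\<close>

lemma of_int_poly_hom_mult:
  "map_poly of_int (p * q) = map_poly of_int p * (map_poly of_int q :: 'a::comm_ring_1 poly)"
  by (intro poly_eqI) (simp add: coeff_map_poly coeff_mult)

lemma of_int_poly_hom_add:
  "map_poly of_int (p + q) = map_poly of_int p + (map_poly of_int q :: 'a::comm_ring_1 poly)"
  by (intro poly_eqI) (simp add: coeff_map_poly)

lemma of_int_poly_pderiv:
  "map_poly of_int (pderiv p) = (pderiv (map_poly of_int p) :: 'a::idom poly)"
  by (intro poly_eqI) (simp add: coeff_map_poly coeff_pderiv)

lemma monic_int_poly_degree:
  fixes P :: "int poly"
  assumes "lead_coeff P = 1"
  shows "degree (map_poly of_int P :: complex poly) = degree P"
    and "lead_coeff (map_poly of_int P :: complex poly) = 1"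
proof -
  show d: "degree (map_poly of_int P :: complex poly) = degree P"
    by (rule degree_map_poly) (use assms in auto)
  show "lead_coeff (map_poly of_int P :: complex poly) = 1"
    using assms unfolding d by (simp add: coeff_map_poly)
qed

text \<open>Euler's idea: the sum is the coefficient of \<open>x\<^sup>n\<^sup>-\<^sup>1\<close> in the remainder of \<open>f P'\<close>
  modulo \<open>P\<close>, where \<open>n = deg P\<close>, and this division can be done over the integers.\<close>

lemma sum_over_roots_integer:
  fixes P f :: "int poly"
  assumes "lead_coeff P = 1"
  defines "Q \<equiv> map_poly of_int P :: complex poly"
  shows "(\<Sum>z | poly Q z = 0. of_nat (order z Q) * poly (map_poly of_int f) z) \<in> \<int>"
proof (cases "degree P = 0")
  case True
  then have "degree Q = 0" "lead_coeff Q = 1"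
    using monic_int_poly_degree[OF assms(1)] by (auto simp: Q_def)
  then have "Q = 1" by (metis degree_eq_zeroE lead_coeff_pCons(2) one_pCons)
  then show ?thesis by simp
next
  case False
  note dQ = monic_int_poly_degree[OF assms(1), folded Q_def]
  then have Q0: "Q \<noteq> 0" by auto
  define F :: "complex poly" where "F = map_poly of_int f"
  have Qd: "Q = (\<Prod>z\<in>#proots Q. [:-z, 1:])"
    using complex_poly_decompose_multiset[of Q] dQ by simp
  have sz: "size (proots Q) = degree P" using size_proots_complex[of Q] dQ by simp
  obtain K R where KR: "F * pderiv Q = K * Q + R" "\<forall>i\<ge>degree P. coeff R i = 0"
    "coeff (pCons 0 R) (degree P) = (\<Sum>z\<in>#proots Q. poly F z)"
    using pderiv_linear_prod_decomp[OF Qd, of F] unfolding sz by blast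
  have P0: "P \<noteq> 0" using False by auto
  obtain q r where qr: "pseudo_divmod (f * pderiv P) P = (q, r)" by (cases "pseudo_divmod (f * pderiv P) P")
  \<comment> \<open>\<open>pseudo_divmod\<close> scales the dividend by a power of
    \<open>lead_coeff P\<close>; as that is 1, this is honest division with remainder over the
    integers.\<close>
  have e: "f * pderiv P = P * q + r" and r: "r = 0 \<or> degree r < degree P"
    using pseudo_divmod[OF P0 qr] assms(1) by auto
  define R' :: "complex poly" where "R' = map_poly of_int r"
  define K' :: "complex poly" where "K' = map_poly of_int q"
  have "F * pderiv Q = Q * K' + R'"
    using arg_cong[OF e, of "map_poly of_int :: int poly \<Rightarrow> complex poly"]
    by (simp add: of_int_poly_hom_mult of_int_poly_hom_add of_int_poly_pderiv F_def Q_def R'_def K'_def)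
  with KR(1) have eq: "(K - K') * Q = R' - R" by (simp add: algebra_simps)
  have R': "coeff R' i = 0" if "i \<ge> degree P" for i
    using r that by (auto simp: R'_def coeff_map_poly coeff_eq_0)
  \<comment> \<open>Uniqueness of division with remainder: a nonzero multiple of \<open>Q\<close>
    has degree at least \<open>degree P\<close>, but \<open>R' - R\<close> has smaller
    degree.\<close>
  have "K - K' = 0"
  proof (rule ccontr)
    assume n: "K - K' \<noteq> 0"
    then have "degree ((K - K') * Q) = degree (K - K') + degree P"
      using Q0 dQ by (simp add: degree_mult_eq)
    moreover have "degree (R' - R) < degree P"
      using False R' KR(2) by (intro coeff_0_degree_minus_1 degree_lessI) auto
    ultimately show False unfolding eq by simp
  qed
  then have "R' = R" using eq by simp
  then have "coeff (pCons 0 R) (degree P) \<in> \<int>"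
    by (cases "degree P") (auto simp: R'_def coeff_map_poly)
  also have "coeff (pCons 0 R) (degree P) = (\<Sum>z | poly Q z = 0. of_nat (order z Q) * poly F z)"
    unfolding KR(3) using Q0 by (simp add: sum_mset_eq_sum_count)
  finally show ?thesis by (simp add: F_def)
qed

text \<open>Real coefficients make \<open>Q\<close> invariant under conjugation, which carries a
  factor \<open>(x - z)^k\<close> to \<open>(x - cnj z)^k\<close>. The resulting inequality, used
  for \<open>z\<close> and for \<open>cnj z\<close>, gives equality.\<close>

lemma order_cnj_int_poly:
  fixes P :: "int poly"
  defines "Q \<equiv> map_poly of_int P :: complex poly"
  assumes "Q \<noteq> 0"
  shows "order (cnj z) Q = order z Q"
proof -
  have cQ: "cnj (poly Q (cnj x)) = poly Q x" for x
    using poly_cnj_real[of Q "cnj x"] by (simp add: Q_def coeff_map_poly)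
  have le: "order z Q \<le> order (cnj z) Q" for z
  proof -
    obtain R where R: "Q = [:-z, 1:] ^ order z Q * R" using order_1[of z Q] by (auto elim: dvdE)
    have "poly Q x = poly ([:- cnj z, 1:] ^ order z Q * map_poly cnj R) x" for x
    proof -
      have "poly Q x = cnj (poly ([:-z, 1:] ^ order z Q * R) (cnj x))"
        using cQ[of x] R by metis
      then show ?thesis by simp
    qed
    then have "Q = [:- cnj z, 1:] ^ order z Q * map_poly cnj R"
      using poly_eq_poly_eq_iff by blast
    then show ?thesis using assms(2) order_divides[of "cnj z" "order z Q" Q]
      by (metis dvd_triv_left)
  qed
  show ?thesis using le[of z] le[of "cnj z"] by simp
qed

text \<open>Multiplying \<open>f\<close> by \<open>x^n\<close> makes the sum over all roots an
  integer for each \<open>n\<close>. The roots outside \<open>S\<close> form the error, a finite sum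
  of geometric sequences with ratios below 1.\<close>

lemma dominant_root_sums_near_integers:
  fixes P f :: "int poly"
  assumes "lead_coeff P = 1"
  defines "Q \<equiv> map_poly of_int P :: complex poly"
  assumes roots: "\<And>z. poly Q z = 0 \<Longrightarrow> z \<notin> S \<Longrightarrow> cmod z < 1" and S: "\<And>z. z \<in> S \<Longrightarrow> poly Q z = 0"
  obtains \<epsilon> :: "nat \<Rightarrow> real" and N :: "nat \<Rightarrow> int" where "summable \<epsilon>"
    "\<And>n. \<bar>Re (\<Sum>z\<in>S. of_nat (order z Q) * z ^ n * poly (map_poly of_int f) z) - of_int (N n)\<bar> \<le> \<epsilon> n"
proof -
  define F :: "complex poly" where "F = map_poly of_int f"
  define T where "T = {z. poly Q z = 0} - S"
  have "Q \<noteq> 0" using monic_int_poly_degree(2)[OF assms(1)] by (auto simp: Q_def)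
  then have fin: "finite {z. poly Q z = 0}" using poly_roots_finite by blast
  have "(\<Sum>z | poly Q z = 0. of_nat (order z Q) * z ^ n * poly F z) \<in> \<int>" for n
    using sum_over_roots_integer[OF assms(1), of "monom 1 n * f"]
    by (simp add: of_int_poly_hom_mult map_poly_monom poly_monom F_def Q_def mult.assoc)
  then obtain N where N: "(\<Sum>z | poly Q z = 0. of_nat (order z Q) * z ^ n * poly F z) = of_int (N n)" for n
    unfolding Ints_def by atomize_elim (rule choice, blast)
  define \<epsilon> where "\<epsilon> n = (\<Sum>z\<in>T. (of_nat (order z Q) * cmod (poly F z)) * cmod z ^ n)" for n
  have "summable \<epsilon>" unfolding \<epsilon>_def using roots
    by (intro summable_sum summable_mult summable_geometric) (auto simp: T_def)
  moreover have "\<bar>Re (\<Sum>z\<in>S. of_nat (order z Q) * z ^ n * poly F z) - of_int (N n)\<bar> \<le> \<epsilon> n" for n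
  proof -
    let ?g = "\<lambda>z. of_nat (order z Q) * z ^ n * poly F z"
    have "sum ?g {z. poly Q z = 0} = sum ?g T + sum ?g S"
      unfolding T_def using fin S by (intro sum.subset_diff) auto
    then have "sum ?g S - of_int (N n) = - sum ?g T" unfolding N by simp
    then have "Re (sum ?g S - of_int (N n)) = Re (- sum ?g T)" by (rule arg_cong)
    then have "Re (sum ?g S) - of_int (N n) = Re (- sum ?g T)" by simp
    then have "\<bar>Re (sum ?g S) - of_int (N n)\<bar> \<le> cmod (sum ?g T)"
      using abs_Re_le_cmod[of "- sum ?g T"] by simp
    also have "\<dots> \<le> \<epsilon> n" unfolding \<epsilon>_def
      by (rule order_trans[OF norm_sum]) (simp add: norm_mult norm_power mult.assoc mult.left_commute mult.commute)
    finally show ?thesis .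
  qed
  ultimately show thesis by (rule that[of \<epsilon> N, folded F_def])
qed

text \<open>This is the nondegeneracy of a Vandermonde system. By linearity the powers may be
  replaced by any polynomial, and one vanishing exactly on \<open>S - {y}\<close> isolates
  \<open>c y\<close>.\<close>

lemma sum_powers_eq_0_imp_coeffs_0:
  fixes c :: "'a::idom \<Rightarrow> 'a"
  assumes "finite S" "\<And>n. (\<Sum>z\<in>S. z ^ n * c z) = 0" "y \<in> S"
  shows "c y = 0"
proof -
  have *: "(\<Sum>z\<in>S. poly p z * c z) = 0" for p
  proof -
    have "(\<Sum>z\<in>S. poly p z * c z) = (\<Sum>z\<in>S. \<Sum>i\<le>degree p. coeff p i * (z ^ i * c z))"
      by (simp add: poly_altdef sum_distrib_right mult.assoc)
    also have "\<dots> = (\<Sum>i\<le>degree p. coeff p i * (\<Sum>z\<in>S. z ^ i * c z))"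
      by (subst sum.swap) (simp add: sum_distrib_left)
    finally show ?thesis using assms by simp
  qed
  define p where "p = (\<Prod>x\<in>S - {y}. [:-x, 1:])"
  have "poly p z = 0" if "z \<in> S - {y}" for z
    using that assms(1) by (auto simp: p_def poly_prod)
  then have "(\<Sum>z\<in>S. poly p z * c z) = poly p y * c y"
    using assms by (simp add: sum.remove[of S y])
  moreover have "poly p y \<noteq> 0" using assms(1) by (auto simp: p_def poly_prod)
  ultimately show ?thesis using *[of p] by simp
qed

section \<open>Existence and uniqueness of self-affine measures\<close>

lemma bounded_integral_pair_measure_pmf:
  fixes g :: "'a \<times> 'b \<Rightarrow> 'c::{banach, second_countable_topology}"
  assumes "finite I" "set_pmf q \<subseteq> I" "prob_space N"
    and g [measurable]: "g \<in> borel_measurable (measure_pmf q \<Otimes>\<^sub>M N)" and bd: "\<And>z. norm (g z) \<le> C"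
  shows "(LINT z|(measure_pmf q \<Otimes>\<^sub>M N). g z) = (\<Sum>l\<in>I. pmf q l *\<^sub>R (LINT x|N. g (l, x)))"
proof -
  interpret N: prob_space N by fact
  interpret Q: prob_space "measure_pmf q" by (rule prob_space_measure_pmf)
  interpret pair_prob_space "measure_pmf q" N ..
  have "integrable (measure_pmf q \<Otimes>\<^sub>M N) g"
    by (rule integrable_const_bound[where B = C]) (use bd in auto)
  then have "(LINT z|(measure_pmf q \<Otimes>\<^sub>M N). g z) = (LINT l|measure_pmf q. LINT x|N. g (l, x))"
    by (simp add: integral_fst')
  also have "\<dots> = (\<Sum>l\<in>I. pmf q l *\<^sub>R (LINT x|N. g (l, x)))"
    by (rule integral_measure_pmf) (use assms in auto)
  finally show ?thesis .
qed

lemma ifs_map_borel_measurable [measurable]: "ifs_map A a l \<in> borel_measurable borel"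
proof -
  have "continuous_on UNIV (ifs_map A a l)"
    unfolding ifs_map_def
    by (intro continuous_intros linear_continuous_on matrix_vector_mul_bounded_linear)
  then show ?thesis by (rule borel_measurable_continuous_onI)
qed

text \<open>\<open>A\<close> need not contract the Euclidean norm; contraction is recorded as
  summability of every orbit, which avoids an adapted norm.\<close>

locale iterated_random_maps =
  fixes m :: nat and A :: "real ^ 'd ^ 'd" and a :: "nat \<Rightarrow> real ^ 'd" and p :: "nat \<Rightarrow> real"
  assumes p: "probability_vector m p"
    and iterates_summable: "\<And>v. summable (\<lambda>n. norm ((((*v) A) ^^ n) v))"
begin

definition q :: "nat pmf" where "q = embed_pmf (\<lambda>l. if l \<in> {1..m} then p l else 0)"

lemma pmf_q: "pmf q l = (if l \<in> {1..m} then p l else 0)"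
proof -
  have "(\<integral>\<^sup>+ l. ennreal (if l \<in> {1..m} then p l else 0) \<partial>count_space UNIV)
      = (\<Sum>l\<in>{1..m}. ennreal (if l \<in> {1..m} then p l else 0))"
    by (rule nn_integral_count_space') auto
  also have "\<dots> = ennreal (\<Sum>l\<in>{1..m}. p l)"
    using p by (subst sum_ennreal[symmetric]) (auto simp: probability_vector_def)
  also have "\<dots> = 1" using p by (simp add: probability_vector_def)
  finally show ?thesis
    unfolding q_def using p by (subst pmf_embed_pmf) (auto simp: probability_vector_def)
qed

lemma set_pmf_q: "set_pmf q \<subseteq> {1..m}"
  by (auto simp: set_pmf_iff pmf_q split: if_splits)

lemma average_eq_pair_integral:
  fixes g :: "nat \<times> 'b \<Rightarrow> 'c::{banach, second_countable_topology}"
  assumes "prob_space N" "g \<in> borel_measurable (measure_pmf q \<Otimes>\<^sub>M N)" "\<And>z. norm (g z) \<le> C"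
  shows "(LINT z|(measure_pmf q \<Otimes>\<^sub>M N). g z) = (\<Sum>l=1..m. p l *\<^sub>R (LINT x|N. g (l, x)))"
  using bounded_integral_pair_measure_pmf[OF _ set_pmf_q assms] by (simp add: pmf_q)

text \<open>This is the condition under \<open>THE\<close> in \<open>self_affine_measure\<close>;
  existence and uniqueness below make that description meaningful.\<close>

definition self_affine :: "(real ^ 'd) measure \<Rightarrow> bool" where
  "self_affine \<mu> \<longleftrightarrow> borel_probability_measure \<mu> \<and>
     (\<forall>B\<in>sets borel. measure \<mu> B = (\<Sum>l=1..m. p l * measure (distr \<mu> borel (ifs_map A a l)) B))"

lemma ifs_pair_measurable:
  assumes "sets \<mu> = sets borel"
  shows "(\<lambda>(l, x). ifs_map A a l x) \<in> borel_measurable (measure_pmf q \<Otimes>\<^sub>M \<mu>)"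
proof -
  have "ifs_map A a l \<in> measurable \<mu> borel" for l
    by (simp add: measurable_cong_sets[OF assms refl])
  then have "(\<lambda>z. ifs_map A a l (snd z)) \<in> borel_measurable (measure_pmf q \<Otimes>\<^sub>M \<mu>)" for l
    by (rule measurable_compose[OF measurable_snd])
  moreover have "fst \<in> measurable (measure_pmf q \<Otimes>\<^sub>M \<mu>) (count_space UNIV)"
    using measurable_fst[of "measure_pmf q" \<mu>] by (simp add: measurable_measure_pmf)
  ultimately show ?thesis
    unfolding split_beta
    by (rule measurable_compose_countable[where f = "\<lambda>l z. ifs_map A a l (snd z)"])
qed

lemma measure_distr_ifs:
  assumes "borel_probability_measure \<mu>" "B \<in> sets borel"
  shows "measure (distr \<mu> borel (ifs_map A a l)) B = (LINT x|\<mu>. indicator B (ifs_map A a l x))"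
proof -
  have s: "sets \<mu> = sets borel" and "prob_space \<mu>"
    using assms by (auto simp: borel_probability_measure_def)
  interpret prob_space \<mu> by fact
  have ms: "ifs_map A a l \<in> measurable \<mu> borel"
    using s by (simp cong: measurable_cong_sets)
  interpret D: prob_space "distr \<mu> borel (ifs_map A a l)" by (rule prob_space_distr[OF ms])
  have "measure (distr \<mu> borel (ifs_map A a l)) B
      = (LINT x|(distr \<mu> borel (ifs_map A a l)). indicator B x)"
    using assms(2) by simp
  also have "\<dots> = (LINT x|\<mu>. indicator B (ifs_map A a l x))"
    by (rule integral_distr[OF ms]) (use assms(2) in measurable)
  finally show ?thesis .
qed

text \<open>Self-affinity means that applying a \<open>q\<close>-random map to an independent
  \<open>\<mu>\<close>-random point reproduces \<open>\<mu>\<close>. Change of variables and Fubini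
  extend this from sets to bounded functions; the general codomain serves both the real transfer
  operator and the complex Fourier transform.\<close>

lemma self_affine_integral:
  fixes f :: "real ^ 'd \<Rightarrow> 'c::{banach, second_countable_topology}"
  assumes \<mu>: "self_affine \<mu>" and f [measurable]: "f \<in> borel_measurable borel" and bd: "\<And>x. norm (f x) \<le> C"
  shows "(LINT x|\<mu>. f x) = (\<Sum>l=1..m. p l *\<^sub>R (LINT x|\<mu>. f (ifs_map A a l x)))"
proof -
  have bp: "borel_probability_measure \<mu>" using \<mu> by (simp add: self_affine_def)
  then have s: "sets \<mu> = sets borel" and P: "prob_space \<mu>"
    by (auto simp: borel_probability_measure_def)
  interpret prob_space \<mu> by fact
  let ?D = "distr (measure_pmf q \<Otimes>\<^sub>M \<mu>) borel (\<lambda>(l, x). ifs_map A a l x)"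
  note ms = ifs_pair_measurable[OF s]
  interpret Q: pair_prob_space "measure_pmf q" \<mu> ..
  interpret D: prob_space ?D by (rule Q.prob_space_distr[OF ms])
  have "\<mu> = ?D"
  proof (rule measure_eqI)
    show "sets \<mu> = sets ?D" using s by simp
    fix B assume "B \<in> sets \<mu>"
    then have B [measurable]: "B \<in> sets borel" using s by simp
    have "measure ?D B = (LINT x|?D. indicator B x)" by simp
    also have "\<dots> = (LINT z|(measure_pmf q \<Otimes>\<^sub>M \<mu>). indicator B (case z of (l, x) \<Rightarrow> ifs_map A a l x))"
      by (rule integral_distr[OF ms]) measurable
    also have "\<dots> = (\<Sum>l=1..m. p l *\<^sub>R (LINT x|\<mu>. indicator B (ifs_map A a l x)))"
      by (subst average_eq_pair_integral[OF P, where C = 1])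
         (auto intro!: measurable_compose[OF ms] simp: indicator_def)
    also have "\<dots> = measure \<mu> B"
      using \<mu> B by (simp add: self_affine_def measure_distr_ifs[OF bp B])
    finally show "emeasure \<mu> B = emeasure ?D B"
      by (simp add: emeasure_eq_measure D.emeasure_eq_measure)
  qed
  then have "(LINT x|\<mu>. f x) = (LINT x|?D. f x)" by simp
  also have "\<dots> = (LINT z|(measure_pmf q \<Otimes>\<^sub>M \<mu>). f (case z of (l, x) \<Rightarrow> ifs_map A a l x))"
    by (rule integral_distr[OF ms]) measurable
  also have "\<dots> = (\<Sum>l=1..m. p l *\<^sub>R (LINT x|\<mu>. f (ifs_map A a l x)))"
    by (subst average_eq_pair_integral[OF P, where C = C])
       (auto intro!: measurable_compose[OF ms] bd)
  finally show ?thesis .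
qed

section \<open>Existence through the coding map\<close>

definition translation :: "nat \<Rightarrow> real ^ 'd" where "translation l = (if l \<in> {1..m} then a l else 0)"

text \<open>For indices in \<open>{1..m}\<close> this is the limit, at the origin, of compositions
  of the maps with indices \<open>\<omega> 0\<close>, \<open>\<omega> 1\<close>, ..., the last one
  being applied first.\<close>

definition coding_map :: "(nat \<Rightarrow> nat) \<Rightarrow> real ^ 'd" where
  "coding_map \<omega> = (\<Sum>n. (((*v) A) ^^ n) (translation (\<omega> n)))"

lemma coding_map_summable: "summable (\<lambda>n. (((*v) A) ^^ n) (translation (\<omega> n)))"
proof (rule summable_comparison_test')
  show "summable (\<lambda>n. \<Sum>l=1..m. norm ((((*v) A) ^^ n) (a l)))"
    by (rule summable_sum) (rule iterates_summable)
  show "norm ((((*v) A) ^^ n) (translation (\<omega> n))) \<le> (\<Sum>l=1..m. norm ((((*v) A) ^^ n) (a l)))"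
    if "n \<ge> 0" for n
  proof (cases "\<omega> n \<in> {1..m}")
    case True
    then have "norm ((((*v) A) ^^ n) (a (\<omega> n))) \<le> (\<Sum>l=1..m. norm ((((*v) A) ^^ n) (a l)))"
      by (intro member_le_sum) auto
    then show ?thesis using True by (simp add: translation_def)
  next
    \<comment> \<open>The default translation 0 makes the series converge for every index sequence,
      so \<open>coding_map\<close> is meaningful on the whole sequence space.\<close>
    case False
    have "(((*v) A) ^^ n) 0 = 0" by (induction n) auto
    moreover have "translation (\<omega> n) = 0" using False by (simp add: translation_def del: atLeastAtMost_iff)
    ultimately show ?thesis by (simp add: sum_nonneg)
  qed
qed

lemma coding_map_case_nat:
  assumes "s \<in> {1..m}"
  shows "coding_map (case_nat s \<omega>) = ifs_map A a s (coding_map \<omega>)"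
proof -
  let ?f = "\<lambda>n. (((*v) A) ^^ n) (translation (case_nat s \<omega> n))"
  have "(\<Sum>n. ?f (Suc n)) = (\<Sum>n. A *v (((*v) A) ^^ n) (translation (\<omega> n)))" by simp
  also have "\<dots> = A *v coding_map \<omega>"
    unfolding coding_map_def
    by (rule bounded_linear.suminf[OF matrix_vector_mul_bounded_linear coding_map_summable, symmetric])
  finally have "A *v coding_map \<omega> = coding_map (case_nat s \<omega>) - ?f 0"
    unfolding coding_map_def[of "case_nat s \<omega>"]
    using suminf_split_head[OF coding_map_summable[of "case_nat s \<omega>"]] by simp
  then show ?thesis using assms by (simp add: ifs_map_def translation_def)
qed

text \<open>The measure is the law of \<open>coding_map\<close> under independent
  \<open>q\<close>-distributed indices. Prepending an independent index preserves the law of the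
  sequence (\<open>PiM_iter\<close>), and \<open>coding_map\<close> turns prepending into applying
  the corresponding map.\<close>

lemma self_affine_exists: "\<exists>\<mu>. self_affine \<mu>"
proof -
  interpret sequence_space "measure_pmf q" ..
  have PS: "prob_space S" by (rule prob_space_PiM) (rule prob_space_measure_pmf)
  have X [measurable]: "coding_map \<in> borel_measurable S"
    unfolding coding_map_def
    by (intro borel_measurable_suminf measurable_compose[OF measurable_component_singleton]) auto
  define \<mu> where "\<mu> = distr S borel coding_map"
  interpret \<mu>: prob_space \<mu> unfolding \<mu>_def by (rule prob_space.prob_space_distr[OF PS X])
  have bp: "borel_probability_measure \<mu>"
    unfolding borel_probability_measure_def using \<mu>.prob_space_axioms by (simp add: \<mu>_def)
  have "measure \<mu> B = (\<Sum>l=1..m. p l * measure (distr \<mu> borel (ifs_map A a l)) B)"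
    if B [measurable]: "B \<in> sets borel" for B
  proof -
    let ?c = "\<lambda>(s, \<omega>). case_nat s \<omega>"
    have c [measurable]: "?c \<in> measurable (measure_pmf q \<Otimes>\<^sub>M S) S" by measurable
    have "measure \<mu> B = (LINT x|\<mu>. indicator B x)" using B by (simp add: \<mu>_def)
    also have "\<dots> = (LINT \<omega>|S. indicator B (coding_map \<omega>))"
      unfolding \<mu>_def by (rule integral_distr) measurable
    also have "\<dots> = (LINT \<omega>|(distr (measure_pmf q \<Otimes>\<^sub>M S) S ?c). indicator B (coding_map \<omega>))"
      by (simp only: PiM_iter)
    also have "\<dots> = (LINT z|(measure_pmf q \<Otimes>\<^sub>M S). indicator B (coding_map (?c z)))"
      by (rule integral_distr) measurable
    also have "\<dots> = (\<Sum>l=1..m. p l *\<^sub>R (LINT \<omega>|S. indicator B (coding_map (?c (l, \<omega>)))))"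
      by (rule average_eq_pair_integral[OF PS, where C = 1])
         (auto intro!: measurable_compose[OF c measurable_compose[OF X]] simp: indicator_def)
    also have "\<dots> = (\<Sum>l=1..m. p l * (LINT x|\<mu>. indicator B (ifs_map A a l x)))"
    proof (rule sum.cong[OF refl])
      fix l assume l: "l \<in> {1..m}"
      have "(LINT x|\<mu>. indicator B (ifs_map A a l x))
          = (LINT \<omega>|S. indicator B (ifs_map A a l (coding_map \<omega>)) :: real)"
        unfolding \<mu>_def by (rule integral_distr[OF X]) measurable
      then show "p l *\<^sub>R (LINT \<omega>|S. indicator B (coding_map (?c (l, \<omega>)))) =
          p l * (LINT x|\<mu>. indicator B (ifs_map A a l x))"
        by (simp only: coding_map_case_nat[OF l] prod.case real_scaleR_def)
    qed
    finally show ?thesis by (simp add: measure_distr_ifs[OF bp B])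
  qed
  then show ?thesis using bp unfolding self_affine_def by blast
qed

section \<open>The dual Markov operator and uniqueness\<close>

definition transfer :: "(real ^ 'd \<Rightarrow> real) \<Rightarrow> real ^ 'd \<Rightarrow> real" where
  "transfer f x = (\<Sum>l=1..m. p l * f (ifs_map A a l x))"

lemma transfer_measurable [measurable (raw)]:
  "f \<in> borel_measurable borel \<Longrightarrow> transfer f \<in> borel_measurable borel"
  unfolding transfer_def
  by (intro borel_measurable_sum borel_measurable_times borel_measurable_const
        measurable_compose[OF ifs_map_borel_measurable])

lemma transfer_bound:
  assumes "\<And>x. \<bar>f x\<bar> \<le> C"
  shows "\<bar>transfer f x\<bar> \<le> C"
proof -
  have "\<bar>transfer f x\<bar> \<le> (\<Sum>l=1..m. p l * C)"
    unfolding transfer_def using p assms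
    by (intro order_trans[OF sum_abs] sum_mono)
       (auto simp: abs_mult probability_vector_def intro!: mult_left_mono)
  also have "\<dots> = C" using p by (simp add: probability_vector_def flip: sum_distrib_right)
  finally show ?thesis .
qed

text \<open>The modulus \<open>h\<close> depends on the difference vector and not just on its norm,
  so iteration yields \<open>h (A^n (x - y))\<close>; a Euclidean Lipschitz constant could grow at a
  single step.\<close>

lemma transfer_diff:
  assumes "\<And>x y. \<bar>f x - f y\<bar> \<le> h (x - y)"
  shows "\<bar>transfer f x - transfer f y\<bar> \<le> h (A *v (x - y))"
proof -
  have "ifs_map A a l x - ifs_map A a l y = A *v (x - y)" for l
    by (simp add: ifs_map_def matrix_vector_mult_diff_distrib)
  then have le: "\<bar>f (ifs_map A a l x) - f (ifs_map A a l y)\<bar> \<le> h (A *v (x - y))" for l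
    using assms[of "ifs_map A a l x" "ifs_map A a l y"] by metis
  have "\<bar>transfer f x - transfer f y\<bar> = \<bar>\<Sum>l=1..m. p l * (f (ifs_map A a l x) - f (ifs_map A a l y))\<bar>"
    unfolding transfer_def by (simp add: right_diff_distrib sum_subtractf)
  also have "\<dots> \<le> (\<Sum>l=1..m. p l * h (A *v (x - y)))"
    using p le by (intro order_trans[OF sum_abs] sum_mono)
       (auto simp: abs_mult probability_vector_def intro!: mult_left_mono)
  also have "\<dots> = h (A *v (x - y))"
    using p by (simp add: probability_vector_def flip: sum_distrib_right)
  finally show ?thesis .
qed

lemma transfer_integral:
  assumes \<mu>: "self_affine \<mu>" and f [measurable]: "f \<in> borel_measurable borel" and bd: "\<And>x. \<bar>f x\<bar> \<le> C"
  shows "(LINT x|\<mu>. transfer f x) = (LINT x|\<mu>. f x)"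
proof -
  have s: "sets \<mu> = sets borel" and "prob_space \<mu>"
    using \<mu> by (auto simp: self_affine_def borel_probability_measure_def)
  interpret prob_space \<mu> by fact
  have "integrable \<mu> (\<lambda>x. f (ifs_map A a l x))" for l
    by (rule integrable_const_bound[where B = C])
       (use bd in \<open>auto simp: measurable_cong_sets[OF s refl]\<close>)
  then show ?thesis
    using self_affine_integral[OF \<mu> f, of C] bd by (simp add: transfer_def)
qed

text \<open>The limit does not involve \<open>\<mu>\<close>, which is why there is only one self-affine measure.\<close>

lemma transfer_power_tendsto_integral:
  assumes \<mu>: "self_affine \<mu>" and f: "f \<in> borel_measurable borel" "\<And>x. \<bar>f x\<bar> \<le> C"
    "\<And>x y. \<bar>f x - f y\<bar> \<le> L * norm (x - y)"
  shows "(\<lambda>n. (transfer ^^ n) f 0) \<longlonglongrightarrow> (LINT x|\<mu>. f x)"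
proof -
  have s: "sets \<mu> = sets borel" and "prob_space \<mu>"
    using \<mu> by (auto simp: self_affine_def borel_probability_measure_def)
  interpret prob_space \<mu> by fact
  have m: "(transfer ^^ n) f \<in> borel_measurable borel" for n
    by (induction n) (auto simp: f intro: transfer_measurable)
  have b: "\<bar>(transfer ^^ n) f x\<bar> \<le> C" for n x
    by (induction n arbitrary: x) (auto simp: f intro: transfer_bound)
  have d: "\<bar>(transfer ^^ n) f x - (transfer ^^ n) f y\<bar> \<le> L * norm ((((*v) A) ^^ n) (x - y))" for n x y
  proof (induction n arbitrary: x y)
    case (Suc n)
    show ?case
      using transfer_diff[of "(transfer ^^ n) f" "\<lambda>v. L * norm ((((*v) A) ^^ n) v)" x y, OF Suc]
      by (simp add: funpow_swap1)
  qed (simp add: f)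
  have i: "(LINT x|\<mu>. (transfer ^^ n) f x) = (LINT x|\<mu>. f x)" for n
    by (induction n) (simp_all add: transfer_integral[OF \<mu> m b])
  have int: "integrable \<mu> ((transfer ^^ n) f)" for n
    by (rule integrable_const_bound[where B = C])
       (use b m in \<open>auto simp: measurable_cong_sets[OF s refl]\<close>)
  \<comment> \<open>Invariance keeps the integral of every iterate equal to that of
    \<open>f\<close>, while the deviation of the iterates from their value at 0 tends to 0
    pointwise, dominated by \<open>2 * C\<close>.\<close>
  have "(\<lambda>n. LINT x|\<mu>. (transfer ^^ n) f x - (transfer ^^ n) f 0) \<longlonglongrightarrow> (LINT x|\<mu>. 0)"
  proof (rule integral_dominated_convergence[where w = "\<lambda>_. 2 * C"])
    show "AE x in \<mu>. (\<lambda>n. (transfer ^^ n) f x - (transfer ^^ n) f 0) \<longlonglongrightarrow> 0"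
    proof (intro AE_I2)
      fix x
      have "(\<lambda>n. L * norm ((((*v) A) ^^ n) (x - 0))) \<longlonglongrightarrow> L * 0"
        by (intro tendsto_mult tendsto_const summable_LIMSEQ_zero iterates_summable)
      then have lim: "(\<lambda>n. L * norm ((((*v) A) ^^ n) (x - 0))) \<longlonglongrightarrow> 0" by (simp only: mult_zero_right)
      have "\<forall>\<^sub>F n in sequentially. norm ((transfer ^^ n) f x - (transfer ^^ n) f 0)
          \<le> L * norm ((((*v) A) ^^ n) (x - 0))"
        unfolding real_norm_def by (intro always_eventually allI d)
      from Lim_null_comparison[OF this lim]
      show "(\<lambda>n. (transfer ^^ n) f x - (transfer ^^ n) f 0) \<longlonglongrightarrow> 0" .
    qed
    show "AE x in \<mu>. norm ((transfer ^^ n) f x - (transfer ^^ n) f 0) \<le> 2 * C" for n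
    proof (intro AE_I2)
      fix x
      show "norm ((transfer ^^ n) f x - (transfer ^^ n) f 0) \<le> 2 * C"
        using b[of n x] b[of n 0] unfolding real_norm_def by linarith
    qed
    show "(\<lambda>x. (transfer ^^ n) f x - (transfer ^^ n) f 0) \<in> borel_measurable \<mu>" for n
      unfolding measurable_cong_sets[OF s refl]
      by (intro borel_measurable_diff borel_measurable_const m)
  qed simp_all
  then have "(\<lambda>n. (LINT x|\<mu>. f x) - (transfer ^^ n) f 0) \<longlonglongrightarrow> 0"
    using int i by (simp add: prob_space)
  from tendsto_diff[OF tendsto_const this, of "LINT x|\<mu>. f x"] show ?thesis by simp
qed

text \<open>Integrals of bounded Lipschitz functions are determined by a limit common to both
  measures. Such functions approximate indicators of closed sets, and the closed sets are an
  intersection-stable generator of the Borel sets.\<close>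

lemma self_affine_unique:
  assumes \<mu>: "self_affine \<mu>" and \<nu>: "self_affine \<nu>"
  shows "\<mu> = \<nu>"
proof -
  have s: "sets \<mu> = sets borel" "sets \<nu> = sets borel" and P: "prob_space \<mu>" "prob_space \<nu>"
    using \<mu> \<nu> by (auto simp: self_affine_def borel_probability_measure_def)
  interpret M: prob_space \<mu> by fact
  interpret N: prob_space \<nu> by fact
  have eq: "(LINT x|\<mu>. f x) = (LINT x|\<nu>. f x)"
    if "f \<in> borel_measurable borel" "\<And>x. \<bar>f x\<bar> \<le> C" "\<And>x y. \<bar>f x - f y\<bar> \<le> L * norm (x - y)" for f C L
    using transfer_power_tendsto_integral[OF \<mu> that] transfer_power_tendsto_integral[OF \<nu> that]
    by (rule LIMSEQ_unique)
  \<comment> \<open>For empty \<open>F\<close> the convention \<open>infdist x {} = 0\<close> would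
    make the cut-offs constantly 1, so that case is treated separately at the end.\<close>
  have closed: "measure \<mu> F = measure \<nu> F" if F: "closed F" "F \<noteq> {}" for F :: "(real ^ 'd) set"
  proof -
    define f where "f n x = max 0 (1 - real n * infdist x F)" for n x
    have fm: "f n \<in> borel_measurable borel" for n
      unfolding f_def by (intro borel_measurable_continuous_onI continuous_intros)
    have fb: "\<bar>f n x\<bar> \<le> 1" for n x
      unfolding f_def using infdist_nonneg[of x F] by (auto simp: max_def)
    have fL: "\<bar>f n x - f n y\<bar> \<le> real n * norm (x - y)" for n x y
    proof -
      have "\<bar>f n x - f n y\<bar> \<le> \<bar>real n * infdist x F - real n * infdist y F\<bar>"
        unfolding f_def by (auto simp: max_def)
      also have "\<dots> = real n * \<bar>infdist x F - infdist y F\<bar>"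
        by (simp add: abs_mult flip: right_diff_distrib)
      also have "\<dots> \<le> real n * norm (x - y)"
        using infdist_triangle[of x F y] infdist_triangle[of y F x]
        by (intro mult_left_mono) (auto simp: dist_norm norm_minus_commute)
      finally show ?thesis .
    qed
    have lim: "(\<lambda>n. f n x) \<longlonglongrightarrow> indicator F x" for x
    proof (cases "x \<in> F")
      case True
      then show ?thesis by (simp add: f_def)
    next
      case False
      then have pos: "infdist x F > 0" using F infdist_pos_not_in_closed by blast
      obtain k :: nat where k: "1 / infdist x F < real k" using reals_Archimedean2 by blast
      have "f n x = 0" if "n \<ge> k" for n
      proof -
        have "1 / infdist x F \<le> real n" using k that by linarith
        then show ?thesis using pos by (simp add: f_def field_simps)
      qed
      then have "eventually (\<lambda>n. f n x = 0) sequentially" unfolding eventually_sequentially by blast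
      then show ?thesis using False by (simp add: tendsto_eventually)
    qed
    have conv: "(\<lambda>n. LINT x|\<rho>. f n x) \<longlonglongrightarrow> measure \<rho> F"
      if "prob_space \<rho>" "sets \<rho> = sets borel" for \<rho>
    proof -
      interpret prob_space \<rho> by fact
      have FS: "F \<in> sets \<rho>" using that F by simp
      have "(\<lambda>n. LINT x|\<rho>. f n x) \<longlonglongrightarrow> (LINT x|\<rho>. indicator F x)"
        by (rule integral_dominated_convergence[where w = "\<lambda>_. 1"])
           (use fm fb lim FS F in \<open>auto intro!: borel_measurable_indicator borel_closed simp: measurable_cong_sets[OF that(2) refl]\<close>)
      then show ?thesis using FS by simp
    qed
    have "(LINT x|\<mu>. f n x) = (LINT x|\<nu>. f n x)" for n by (rule eq[OF fm fb fL])
    then show ?thesis using conv[OF P(1) s(1)] conv[OF P(2) s(2)] LIMSEQ_unique by auto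
  qed
  show ?thesis
  proof (rule measure_eqI_generator_eq)
    show "Int_stable {F :: (real ^ 'd) set. closed F}" by (auto simp: Int_stable_def)
    show "{F. closed F} \<subseteq> Pow (UNIV :: (real ^ 'd) set)" by simp
    show "emeasure \<mu> F = emeasure \<nu> F" if "F \<in> {F. closed F}" for F
      using closed[of F] that
      by (cases "F = {}") (auto simp: M.emeasure_eq_measure N.emeasure_eq_measure)
    show "sets \<mu> = sigma_sets UNIV {F. closed F}" "sets \<nu> = sigma_sets UNIV {F. closed F}"
      unfolding s borel_eq_closed by simp_all
    show "range (\<lambda>_. UNIV) \<subseteq> {F :: (real ^ 'd) set. closed F}" "(\<Union>i::nat. UNIV) = (UNIV :: (real ^ 'd) set)"
      by auto
    show "emeasure \<mu> UNIV \<noteq> \<infinity>" by simp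
  qed
qed

lemma self_affine_self_affine_measure: "self_affine (self_affine_measure m A a p)"
proof -
  have "\<exists>!\<mu>. self_affine \<mu>" using self_affine_exists self_affine_unique by blast
  from theI'[OF this] show ?thesis
    unfolding self_affine_measure_def self_affine_def .
qed

end

section \<open>Frequencies of a generalized Pisot IFS\<close>

lemma complex_vec_mult: "complex_vec (A *v x) = complex_mat A *v complex_vec x"
  by (simp add: complex_vec_def complex_mat_def matrix_vector_mult_def)

lemma norm_complex_vec [simp]: "norm (complex_vec x) = norm x"
  by (simp add: complex_vec_def norm_vec_def)

lemma complex_vec_diff: "complex_vec (x - y) = complex_vec x - complex_vec y"
  by (simp add: complex_vec_def vec_eq_iff)

text \<open>The eigenvalues are complex, so the orbit is estimated after complexification, which
  preserves norms and commutes with applying the matrix.\<close>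

lemma summable_norm_iterates_spectral_radius:
  fixes A :: "real ^ 'd ^ 'd"
  assumes "real_mat_spectral_radius A < 1"
  shows "summable (\<lambda>n. norm ((((*v) A) ^^ n) v))"
proof -
  have "cmod c < 1" if "v \<noteq> 0" "complex_mat A *v v = c *s v" for c v
  proof -
    have "finite (complex_eigenvalues A)"
      unfolding complex_eigenvalues_def by (rule finite_eigenvalues)
    moreover have "c \<in> complex_eigenvalues A" using that by (auto simp: complex_eigenvalues_def)
    ultimately have "cmod c \<le> real_mat_spectral_radius A"
      unfolding real_mat_spectral_radius_def by (intro Max_ge) auto
    then show ?thesis using assms by simp
  qed
  then have "summable (\<lambda>n. norm ((((*v) (complex_mat A)) ^^ n) (complex_vec v)))"
    by (rule summable_norm_iterates)
  moreover have "(((*v) (complex_mat A)) ^^ n) (complex_vec v) = complex_vec ((((*v) A) ^^ n) v)" for n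
    by (induction n) (simp_all add: complex_vec_mult)
  ultimately show ?thesis by simp
qed

lemma hermitian_inner_scale_left: "hermitian_inner (c *s z) w = c * hermitian_inner z w"
  by (simp add: hermitian_inner_def sum_distrib_left mult.assoc)

lemma hermitian_inner_sum_left: "hermitian_inner (\<Sum>z\<in>S. f z) w = (\<Sum>z\<in>S. hermitian_inner (f z) w)"
  unfolding hermitian_inner_def by (simp only: sum_component sum_distrib_right) (rule sum.swap)

lemma hermitian_inner_add_right: "hermitian_inner z (v + w) = hermitian_inner z v + hermitian_inner z w"
  by (simp add: hermitian_inner_def distrib_left sum.distrib)

lemma hermitian_inner_diff_right: "hermitian_inner z (v - w) = hermitian_inner z v - hermitian_inner z w"
  by (simp add: hermitian_inner_def right_diff_distrib sum_subtractf)

lemma complex_vec_add: "complex_vec (x + y) = complex_vec x + complex_vec y"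
  by (simp add: complex_vec_def vec_eq_iff)

lemma hermitian_inner_complex_vec_scaleR:
  "hermitian_inner z (complex_vec (r *\<^sub>R x)) = of_real r * hermitian_inner z (complex_vec x)"
  by (simp add: hermitian_inner_def complex_vec_def sum_distrib_left mult_ac)

text \<open>\<open>A\<close> and \<open>x\<close> are real, so conjugation in the second argument
  has no effect and the adjoint is the plain transpose.\<close>

lemma hermitian_inner_matrix:
  "hermitian_inner z (complex_vec (A *v x)) = hermitian_inner (complex_mat (transpose A) *v z) (complex_vec x)"
proof -
  have "hermitian_inner z (complex_vec (A *v x))
      = (\<Sum>i\<in>UNIV. \<Sum>j\<in>UNIV. z $ i * (of_real (A $ i $ j) * of_real (x $ j)))"
    by (simp add: hermitian_inner_def complex_vec_def matrix_vector_mult_def sum_distrib_left)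
  also have "\<dots> = (\<Sum>j\<in>UNIV. \<Sum>i\<in>UNIV. z $ i * (of_real (A $ i $ j) * of_real (x $ j)))"
    by (rule sum.swap)
  also have "\<dots> = hermitian_inner (complex_mat (transpose A) *v z) (complex_vec x)"
    by (simp add: hermitian_inner_def complex_vec_def complex_mat_def transpose_def
        matrix_vector_mult_def sum_distrib_left sum_distrib_right mult_ac)
  finally show ?thesis .
qed

definition re_vec :: "complex ^ 'd \<Rightarrow> real ^ 'd" where
  "re_vec z = (\<chi> i. Re (z $ i))"

lemma inner_re_vec: "re_vec z \<bullet> x = Re (hermitian_inner z (complex_vec x))"
  by (simp add: re_vec_def inner_vec_def hermitian_inner_def complex_vec_def)

lemma re_vec_matrix: "A *v re_vec z = re_vec (complex_mat A *v z)"
  by (simp add: re_vec_def complex_mat_def matrix_vector_mult_def vec_eq_iff)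

text \<open>If it did exist, a level set of \<open>x \<mapsto> \<langle>\<eta>, x\<rangle>\<close> would be invariant under all maps.\<close>

lemma irreducible_no_orthogonal_eigenvector:
  fixes A :: "real ^ 'd ^ 'd"
  assumes irr: "affinely_irreducible m A a" and inv: "invertible A"
    and sum: "\<And>v. summable (\<lambda>n. norm ((((*v) A) ^^ n) v))"
    and \<eta>: "complex_mat (transpose A) *v \<eta> = c *s \<eta>" "\<eta> \<noteq> 0" and c: "c \<noteq> 0"
    and orth: "\<And>l. l \<in> {1..m} \<Longrightarrow> hermitian_inner \<eta> (complex_vec (a l - a 1)) = 0"
  shows False
proof -
  define h where "h x = hermitian_inner \<eta> (complex_vec x)" for x
  have h_add: "h (x + y) = h x + h y" for x y
    by (simp add: h_def complex_vec_add hermitian_inner_add_right)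
  have h_scale: "h (r *\<^sub>R x) = of_real r * h x" for r x
    by (simp add: h_def hermitian_inner_complex_vec_scaleR)
  have h_A: "h (A *v x) = c * h x" for x
    by (simp add: h_def hermitian_inner_matrix \<eta> hermitian_inner_scale_left)
  have ha: "h (a l) = h (a 1)" if "l \<in> {1..m}" for l
    using orth[OF that] by (simp add: h_def complex_vec_diff hermitian_inner_diff_right)
  have h_map: "h (ifs_map A a l x) = c * h x + h (a 1)" if "l \<in> {1..m}" for l x
    using ha[OF that] by (simp add: ifs_map_def h_add h_A)
  \<comment> \<open>Every map acts on values of \<open>h\<close> by the same
    \<open>t \<mapsto> c * t + h (a 1)\<close>. The fixed point \<open>x0\<close> of the first map
    provides a fixed value, hence the invariant level set.\<close>
  define x0 where "x0 = (\<Sum>n. (((*v) A) ^^ n) (a 1))"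
  have s: "summable (\<lambda>n. (((*v) A) ^^ n) (a 1))" by (rule summable_norm_cancel[OF sum])
  have "A *v x0 = (\<Sum>n. A *v (((*v) A) ^^ n) (a 1))"
    unfolding x0_def by (rule bounded_linear.suminf[OF matrix_vector_mul_bounded_linear s])
  also have "\<dots> = x0 - a 1" unfolding x0_def using suminf_split_head[OF s] by simp
  finally have "x0 = A *v x0 + a 1" by simp
  then have x0: "h x0 = c * h x0 + h (a 1)" by (metis h_add h_A)
  define V where "V = {x. h x = h x0}"
  have iff: "ifs_map A a l x \<in> V \<longleftrightarrow> x \<in> V" if "l \<in> {1..m}" for l x
  proof -
    have "h (ifs_map A a l x) = h x0 \<longleftrightarrow> c * h x + h (a 1) = c * h x0 + h (a 1)"
      using x0 h_map[OF that, of x] by simp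
    then show ?thesis using c by (simp add: V_def)
  qed
  have "affine V"
    unfolding affine_def V_def
    by (auto simp: h_add h_scale simp flip: distrib_right of_real_add)
  moreover have "V \<noteq> {}" by (auto simp: V_def)
  moreover have "V \<noteq> UNIV"
  proof
    assume "V = UNIV"
    then have const: "h x = h y" for x y by (metis UNIV_I V_def mem_Collect_eq)
    have "\<eta> $ i = 0" for i
    proof -
      have "\<eta> $ i = h (axis i 1)"
        by (simp add: h_def hermitian_inner_def complex_vec_def axis_def if_distrib cong: if_cong)
      also have "\<dots> = h 0" by (rule const)
      also have "\<dots> = 0" by (simp add: h_def hermitian_inner_def complex_vec_def)
      finally show ?thesis .
    qed
    then show False using \<eta>(2) by (simp add: vec_eq_iff)
  qed
  moreover have "ifs_map A a l ` V = V" if l: "l \<in> {1..m}" for l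
  proof
    show "ifs_map A a l ` V \<subseteq> V" using iff[OF l] by blast
    show "V \<subseteq> ifs_map A a l ` V"
    proof
      fix y assume y: "y \<in> V"
      obtain B where "A ** B = mat 1" using inv by (auto simp: invertible_def)
      then have eq: "y = ifs_map A a l (B *v (y - a l))"
        by (simp add: ifs_map_def matrix_vector_mul_assoc)
      then have "B *v (y - a l) \<in> V" using y iff[OF l, of "B *v (y - a l)"] by simp
      with eq show "y \<in> ifs_map A a l ` V" by (rule image_eqI)
    qed
  qed
  ultimately have "affine V \<and> V \<noteq> {} \<and> V \<noteq> UNIV \<and> (\<forall>l\<in>{1..m}. ifs_map A a l ` V = V)"
    by (intro conjI ballI)
  then show False using irr unfolding affinely_irreducible_def by (elim notE) (rule exI)
qed

text \<open>The eigenvectors belonging to conjugate roots need not be conjugate to each other, so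
  the real part that defines \<open>\<xi>\<close> might cancel. Ruling this out is the task of
  irreducibility.\<close>

lemma pisot_frequencies:
  fixes A :: "real ^ 'd ^ 'd"
  assumes G: "generalized_pisot_ifs m A a" and irr: "affinely_irreducible m A a"
  shows "\<exists>\<xi> :: nat \<Rightarrow> real ^ 'd. \<xi> 0 \<noteq> 0 \<and> (\<forall>n. transpose A *v \<xi> (Suc n) = \<xi> n) \<and>
    (\<forall>l\<in>{1..m}. \<exists>\<epsilon> N. summable \<epsilon> \<and> (\<forall>n. \<bar>\<xi> n \<bullet> (a l - a 1) - of_int (N n)\<bar> \<le> \<epsilon> n))"
proof -
  obtain k \<beta> \<zeta> where inv: "invertible A" and rad: "real_mat_spectral_radius A < 1"
    and k: "1 \<le> k" and \<zeta>: "\<forall>j\<in>{1..k}. \<zeta> j \<noteq> 0" and pisot: "pisot_tuple k \<beta>"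
    and eig: "\<forall>j\<in>{1..k}. complex_mat (transpose A) *v \<zeta> j = inverse (\<beta> j) *s \<zeta> j"
    and trans: "\<forall>l\<in>{1..m}. \<exists>P :: int poly. \<forall>j\<in>{1..k}.
           hermitian_inner (\<zeta> j) (complex_vec (a l - a 1)) = poly (map_poly of_int P) (\<beta> j)"
    using G unfolding generalized_pisot_ifs_def homogeneous_affine_ifs_def
    by (elim conjE exE) (rule that; assumption)
  obtain P :: "int poly" where inj: "inj_on \<beta> {1..k}" and big: "\<forall>j\<in>{1..k}. cmod (\<beta> j) > 1"
    and P: "lead_coeff P = 1" "\<forall>j\<in>{1..k}. poly (map_poly of_int P) (\<beta> j) = 0"
    "\<forall>z. poly (map_poly of_int P) z = 0 \<and> z \<notin> \<beta> ` {1..k} \<longrightarrow> cmod z < 1"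
    using pisot unfolding pisot_tuple_def by (elim conjE exE) (rule that; assumption)
  from trans obtain F :: "nat \<Rightarrow> int poly" where F: "\<forall>l\<in>{1..m}. \<forall>j\<in>{1..k}.
     hermitian_inner (\<zeta> j) (complex_vec (a l - a 1)) = poly (map_poly of_int (F l)) (\<beta> j)"
    using bchoice[OF trans] by (elim exE) (rule that; assumption)
  define Q :: "complex poly" where "Q = map_poly of_int P"
  define S where "S = \<beta> ` {1..k}"
  \<comment> \<open>Indexing the eigenvectors by the roots themselves lets the sums run over
    \<open>S\<close> and be reindexed by conjugation.\<close>
  define Z where "Z z = \<zeta> (the_inv_into {1..k} \<beta> z)" for z
  have Z\<beta>: "Z (\<beta> j) = \<zeta> j" if "j \<in> {1..k}" for j
    unfolding Z_def using the_inv_into_f_f[OF inj that] by simp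
  have Zeig: "complex_mat (transpose A) *v Z z = inverse z *s Z z" if "z \<in> S" for z
    using that eig Z\<beta> by (auto simp: S_def)
  have ZF: "hermitian_inner (Z z) (complex_vec (a l - a 1)) = poly (map_poly of_int (F l)) z"
    if "z \<in> S" "l \<in> {1..m}" for z l
    using that F Z\<beta> by (auto simp: S_def)
  have S1: "cmod z > 1" and SQ: "poly Q z = 0" if "z \<in> S" for z
    using that big P by (auto simp: S_def Q_def)
  have nS: "cmod z < 1" if "poly Q z = 0" "z \<notin> S" for z
    using that P by (auto simp: S_def Q_def)
  have finS: "finite S" by (simp add: S_def)
  have Q0: "Q \<noteq> 0" using monic_int_poly_degree(2)[OF P(1)] by (auto simp: Q_def)
  \<comment> \<open>The conjugate is again a root of \<open>Q\<close> of modulus above 1, and all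
    such roots lie in \<open>S\<close>.\<close>
  have cnjS: "cnj z \<in> S" if "z \<in> S" for z
  proof -
    have "poly Q (cnj z) = cnj (poly Q z)"
      by (rule poly_cnj_real[symmetric]) (simp add: Q_def coeff_map_poly)
    then have "poly Q (cnj z) = 0" using SQ[OF that] by simp
    then show ?thesis using nS[of "cnj z"] S1[OF that] by fastforce
  qed
  \<comment> \<open>Multiplicities are the weights of the integral power sums. Since
    \<open>transpose A\<close> multiplies \<open>Z z\<close> by \<open>inverse z\<close>, it lowers
    the exponent by one.\<close>
  define \<eta> where "\<eta> n = (\<Sum>z\<in>S. (of_nat (order z Q) * z ^ n) *s Z z)" for n
  define \<xi> where "\<xi> n = re_vec (\<eta> n)" for n
  have step: "transpose A *v \<xi> (Suc n) = \<xi> n" for n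
  proof -
    have "complex_mat (transpose A) *v \<eta> (Suc n)
        = (\<Sum>z\<in>S. (of_nat (order z Q) * z ^ Suc n) *s (complex_mat (transpose A) *v Z z))"
      unfolding \<eta>_def
      by (simp only: linear_sum[OF matrix_vector_mul_linear] vector_scalar_commute)
    also have "\<dots> = \<eta> n"
      unfolding \<eta>_def
    proof (rule sum.cong[OF refl])
      fix z assume z: "z \<in> S"
      then have "z \<noteq> 0" using S1 by fastforce
      then show "(of_nat (order z Q) * z ^ Suc n) *s (complex_mat (transpose A) *v Z z)
          = (of_nat (order z Q) * z ^ n) *s Z z"
        unfolding Zeig[OF z] by simp
    qed
    finally show ?thesis by (simp add: \<xi>_def re_vec_matrix)
  qed
  have close: "\<exists>\<epsilon> N. summable \<epsilon> \<and> (\<forall>n. \<bar>\<xi> n \<bullet> (a l - a 1) - of_int (N n)\<bar> \<le> \<epsilon> n)"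
    if l: "l \<in> {1..m}" for l
  proof -
    have eq: "\<xi> n \<bullet> (a l - a 1)
        = Re (\<Sum>z\<in>S. of_nat (order z Q) * z ^ n * poly (map_poly of_int (F l)) z)" for n
      unfolding \<xi>_def inner_re_vec \<eta>_def hermitian_inner_sum_left hermitian_inner_scale_left
      by (intro arg_cong[where f = Re] sum.cong refl) (simp only: ZF[OF _ l])
    obtain \<epsilon> N where "summable \<epsilon>"
      "\<And>n. \<bar>Re (\<Sum>z\<in>S. of_nat (order z Q) * z ^ n * poly (map_poly of_int (F l)) z) - of_int (N n)\<bar> \<le> \<epsilon> n"
      using dominant_root_sums_near_integers[OF P(1), of S "F l", folded Q_def, OF nS SQ] by metis
    then show ?thesis unfolding eq by (intro exI conjI allI)
  qed
  have "\<xi> 0 \<noteq> 0"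
  proof
    assume "\<xi> 0 = 0"
    obtain C where "A ** C = mat 1" using inv by (auto simp: invertible_def)
    then have B: "transpose C ** transpose A = mat 1"
      by (metis matrix_transpose_mul transpose_mat)
    \<comment> \<open>Invertibility of the transpose propagates the vanishing from index 0 to all
      later frequencies.\<close>
    have \<xi>0: "\<xi> n = 0" for n
    proof (induction n)
      case (Suc n)
      have "\<xi> (Suc n) = transpose C *v (transpose A *v \<xi> (Suc n))"
        by (simp only: matrix_vector_mul_assoc B matrix_vector_mul_lid)
      then show ?case by (simp only: step Suc matrix_vector_mult_0_right)
    qed fact
    \<comment> \<open>Vanishing of all real parts, after reindexing the conjugate sum by
      \<open>cnj\<close>, is a power sum relation over \<open>S\<close>, whose coefficients must
      vanish.\<close>
    have Zcnj: "Z z $ i = - cnj (Z (cnj z) $ i)" if z: "z \<in> S" for z i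
    proof -
      define w where "w z = of_nat (order z Q) * (Z z $ i + cnj (Z (cnj z) $ i))" for z
      have "(\<Sum>z\<in>S. z ^ n * w z) = 0" for n
      proof -
        define t where "t = (\<Sum>z\<in>S. of_nat (order z Q) * z ^ n * Z z $ i)"
        have "t = \<eta> n $ i" by (simp add: t_def \<eta>_def)
        then have "Re t = 0" using \<xi>0[of n] by (simp add: \<xi>_def re_vec_def vec_eq_iff)
        have "cnj t = (\<Sum>z\<in>S. of_nat (order z Q) * cnj z ^ n * cnj (Z z $ i))"
          by (simp add: t_def)
        also have "\<dots> = (\<Sum>z\<in>S. of_nat (order z Q) * z ^ n * cnj (Z (cnj z) $ i))"
          by (rule sum.reindex_bij_witness[where i = cnj and j = cnj])
             (auto simp: cnjS order_cnj_int_poly[OF Q0[unfolded Q_def], folded Q_def])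
        finally have "t + cnj t = (\<Sum>z\<in>S. z ^ n * w z)"
          by (simp add: t_def w_def sum.distrib algebra_simps)
        then show ?thesis using \<open>Re t = 0\<close> by (simp add: complex_add_cnj)
      qed
      then have "w z = 0" using sum_powers_eq_0_imp_coeffs_0[OF finS _ z] by blast
      moreover have "order z Q \<noteq> 0" using SQ[OF z] Q0 by (simp add: order_root)
      ultimately have "Z z $ i + cnj (Z (cnj z) $ i) = 0" by (simp add: w_def)
      then show ?thesis by (simp only: eq_neg_iff_add_eq_0)
    qed
    define z where "z = \<beta> 1"
    have z: "z \<in> S" using k by (simp add: z_def S_def)
    \<comment> \<open>By \<open>Zcnj\<close> and the integrality of the coefficients of
      \<open>F l\<close>, the pairing equals its own negative.\<close>
    have orth: "hermitian_inner (Z z) (complex_vec (a l - a 1)) = 0" if l: "l \<in> {1..m}" for l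
    proof -
      have "hermitian_inner (Z z) (complex_vec (a l - a 1))
          = - cnj (hermitian_inner (Z (cnj z)) (complex_vec (a l - a 1)))"
        unfolding hermitian_inner_def by (subst Zcnj[OF z]) (simp add: complex_vec_def sum_negf)
      also have "\<dots> = - cnj (poly (map_poly of_int (F l)) (cnj z))"
        by (simp only: ZF[OF cnjS[OF z] l])
      also have "\<dots> = - poly (map_poly of_int (F l)) z"
        using poly_cnj_real[of "map_poly of_int (F l)" "cnj z"] by (simp add: coeff_map_poly)
      finally show ?thesis using ZF[OF z l] by simp
    qed
    have "inverse z \<noteq> 0" using S1[OF z] by auto
    moreover have "Z z \<noteq> 0" using k \<zeta> by (simp add: z_def Z\<beta>)
    ultimately show False
      using irreducible_no_orthogonal_eigenvector[OF irr inv
          summable_norm_iterates_spectral_radius[OF rad] Zeig[OF z] _ _ orth]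
      by metis
  qed
  then show ?thesis using step close by (intro exI[of _ \<xi>] conjI allI ballI)
qed

section \<open>The Fourier transform along the frequencies\<close>

text \<open>Beyond an \<open>N\<close> where the tail of \<open>\<delta>\<close> sums to less than
  1/2, the inequality between the product of the \<open>1 - \<delta> i\<close> and 1 minus their sum
  keeps \<open>u\<close> above \<open>u N / 2\<close>.\<close>

lemma not_tendsto_0_if_summable_loss:
  fixes u \<delta> :: "nat \<Rightarrow> real"
  assumes u: "\<And>n. 0 < u n" and \<delta>: "summable \<delta>" "\<And>n. 0 \<le> \<delta> n"
    and step: "\<And>n. (1 - \<delta> n) * u n \<le> u (Suc n)"
  shows "\<not> u \<longlonglongrightarrow> 0"
proof
  assume "u \<longlonglongrightarrow> 0"
  obtain N where N: "norm (\<Sum>i. \<delta> (i + N)) < 1 / 2"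
    using suminf_exist_split[OF _ \<delta>(1), of "1 / 2"] by auto
  have sm: "summable (\<lambda>i. \<delta> (i + N))" using \<delta>(1) by (simp add: summable_iff_shift)
  have le: "(\<Sum>i<n. \<delta> (i + N)) \<le> 1 / 2" for n
    using sum_le_suminf[OF sm, of "{..<n}"] \<delta>(2) N by auto
  have low: "(1 - (\<Sum>i<n. \<delta> (i + N))) * u N \<le> u (n + N)" for n
  proof (induction n)
    case (Suc n)
    let ?s = "\<Sum>i<n. \<delta> (i + N)"
    have "\<delta> (n + N) \<le> 1"
      using le[of "Suc n"] sum_nonneg[of "{..<n}" "\<lambda>i. \<delta> (i + N)"] \<delta>(2) by simp
    have "(1 - (?s + \<delta> (n + N))) * u N \<le> (1 - \<delta> (n + N)) * ((1 - ?s) * u N)"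
    proof -
      have "0 \<le> ?s * \<delta> (n + N) * u N"
        using \<delta>(2) u[of N] by (intro mult_nonneg_nonneg sum_nonneg) auto
      then show ?thesis by (simp add: algebra_simps)
    qed
    also have "\<dots> \<le> (1 - \<delta> (n + N)) * u (n + N)"
      using Suc \<open>\<delta> (n + N) \<le> 1\<close> by (intro mult_left_mono) auto
    also have "\<dots> \<le> u (Suc n + N)" using step[of "n + N"] by simp
    finally show ?case by simp
  qed simp
  have "u N / 2 \<le> u (n + N)" for n
  proof -
    have "1 / 2 * u N \<le> (1 - (\<Sum>i<n. \<delta> (i + N))) * u N"
      using le[of n] u[of N] by (intro mult_right_mono) auto
    with low[of n] show ?thesis by simp
  qed
  moreover have "(\<lambda>n. u (n + N)) \<longlonglongrightarrow> 0" using \<open>u \<longlonglongrightarrow> 0\<close> by (rule LIMSEQ_ignore_initial_segment)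
  ultimately have "u N / 2 \<le> 0" by (intro LIMSEQ_le_const) auto
  then show False using u[of N] by simp
qed

text \<open>Periodicity replaces \<open>x\<close> by \<open>x - N\<close>, and a chord of the unit
  circle is no longer than its arc.\<close>

lemma norm_exp_near_integer:
  "cmod (exp (2 * complex_of_real pi * \<i> * complex_of_real x) - 1) \<le> 2 * pi * \<bar>x - of_int N\<bar>"
proof -
  have "exp (2 * complex_of_real pi * \<i> * complex_of_real x)
      = exp (\<i> * complex_of_real (2 * pi * (x - of_int N))) * exp (2 * complex_of_int N * complex_of_real pi * \<i>)"
    unfolding exp_add[symmetric] by (simp add: algebra_simps)
  also have "exp (2 * complex_of_int N * complex_of_real pi * \<i>) = 1"
    by (auto simp: exp_eq_1 intro!: exI[of _ N])
  finally have "cmod (exp (2 * complex_of_real pi * \<i> * complex_of_real x) - 1)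
      = 2 * \<bar>sin (2 * pi * (x - of_int N) / 2)\<bar>"
    by (simp only: mult_1_right dist_exp_i_1)
  also have "\<dots> \<le> 2 * \<bar>2 * pi * (x - of_int N) / 2\<bar>"
    by (intro mult_left_mono abs_sin_x_le_abs_x) simp
  also have "\<dots> = 2 * pi * \<bar>x - of_int N\<bar>" by (simp add: abs_mult)
  finally show ?thesis .
qed

section \<open>Unimodular exponentials and adjoint iterates\<close>

definition unit_exp :: "real \<Rightarrow> complex" where
  "unit_exp x = exp (2 * complex_of_real pi * \<i> * complex_of_real x)"

lemma norm_unit_exp [simp]: "cmod (unit_exp x) = 1"
  by (simp add: unit_exp_def norm_exp_eq_Re)

lemma unit_exp_add: "unit_exp (x + y) = unit_exp x * unit_exp y"
  by (simp add: unit_exp_def ring_distribs exp_add)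

lemma unit_exp_0 [simp]: "unit_exp 0 = 1"
  by (simp add: unit_exp_def)

lemma tendsto_unit_exp: "(f \<longlongrightarrow> l) F \<Longrightarrow> ((\<lambda>x. unit_exp (f x)) \<longlongrightarrow> unit_exp l) F"
  unfolding unit_exp_def by (intro tendsto_intros)

lemma continuous_on_unit_exp [continuous_intros]:
  "continuous_on S f \<Longrightarrow> continuous_on S (\<lambda>x. unit_exp (f x))"
  unfolding unit_exp_def by (intro continuous_intros)

lemma unit_exp_inner_measurable [measurable]:
  "(\<lambda>x. unit_exp (\<xi> \<bullet> x)) \<in> borel_measurable borel"
  by (intro borel_measurable_continuous_onI continuous_intros)

lemma inner_matrix_iterates:
  fixes A :: "real ^ 'd ^ 'd"
  shows "((((*v) (transpose A)) ^^ n) x) \<bullet> y = x \<bullet> ((((*v) A) ^^ n) y)"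
proof (induction n arbitrary: x y)
  case (Suc n)
  have "((((*v) (transpose A)) ^^ Suc n) x) \<bullet> y = (transpose A *v (((*v) (transpose A)) ^^ n) x) \<bullet> y"
    by (simp only: funpow.simps o_apply)
  also have "\<dots> = ((((*v) (transpose A)) ^^ n) x) \<bullet> (A *v y)"
    by (subst (2) transpose_transpose[of A, symmetric], subst dot_lmul_matrix[symmetric])
       (simp add: inner_commute)
  also have "\<dots> = x \<bullet> ((((*v) A) ^^ Suc n) y)" by (simp only: Suc funpow_Suc_right o_apply)
  finally show ?case .
qed simp

section \<open>Product formula and decay along the frequencies\<close>

context iterated_random_maps
begin

abbreviation "\<mu> \<equiv> self_affine_measure m A a p"

text \<open>Taking translations relative to \<open>a 1\<close> discards only a phase of modulus 1,
  matches the differences in the Pisot condition, and makes the first term the constant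
  \<open>p 1\<close>.\<close>

definition symbol :: "real ^ 'd \<Rightarrow> complex" where
  "symbol \<xi> = (\<Sum>l=1..m. of_real (p l) * unit_exp (\<xi> \<bullet> (a l - a 1)))"

lemma fourier_self_affine:
  "cmod (fourier_transform \<mu> \<xi>) = cmod (symbol \<xi>) * cmod (fourier_transform \<mu> (transpose A *v \<xi>))"
proof -
  have F: "fourier_transform \<mu> \<xi> = (LINT x|\<mu>. unit_exp (\<xi> \<bullet> x))" for \<xi>
    by (simp add: fourier_transform_def unit_exp_def)
  have e: "unit_exp (\<xi> \<bullet> ifs_map A a l x)
      = unit_exp (\<xi> \<bullet> a 1) * unit_exp (\<xi> \<bullet> (a l - a 1)) * unit_exp ((transpose A *v \<xi>) \<bullet> x)" for l x
    using inner_matrix_iterates[where A = A and n = 1 and x = \<xi> and y = x]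
    by (simp add: ifs_map_def inner_add_right flip: unit_exp_add) (simp add: algebra_simps)
  have "fourier_transform \<mu> \<xi> = (\<Sum>l=1..m. p l *\<^sub>R (LINT x|\<mu>. unit_exp (\<xi> \<bullet> ifs_map A a l x)))"
    unfolding F
    by (rule self_affine_integral[OF self_affine_self_affine_measure, where C = 1]) auto
  also have "\<dots> = unit_exp (\<xi> \<bullet> a 1) * symbol \<xi> * fourier_transform \<mu> (transpose A *v \<xi>)"
    unfolding e F symbol_def
    by (simp add: sum_distrib_left sum_distrib_right scaleR_conv_of_real mult_ac)
  finally show ?thesis by (simp add: norm_mult)
qed

text \<open>The first term is exactly \<open>p 1\<close>, and the others can cancel at most their
  total weight \<open>1 - p 1\<close>.\<close>

lemma norm_symbol_ge:
  assumes "1 \<le> m"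
  shows "2 * p 1 - 1 \<le> cmod (symbol \<xi>)"
proof -
  have s: "{1..m} = insert 1 {2..m}" using assms by auto
  have "(\<Sum>l=1..m. p l) = 1" "\<And>l. l \<in> {1..m} \<Longrightarrow> 0 \<le> p l"
    using p by (auto simp: probability_vector_def)
  then have p2: "(\<Sum>l=2..m. p l) = 1 - p 1" and pos: "\<And>l. l \<in> {2..m} \<Longrightarrow> 0 \<le> p l" "0 \<le> p 1"
    unfolding s by auto
  let ?r = "\<Sum>l=2..m. of_real (p l) * unit_exp (\<xi> \<bullet> (a l - a 1))"
  have "cmod ?r \<le> (\<Sum>l=2..m. p l)"
    by (rule order_trans[OF norm_sum]) (auto intro!: sum_mono simp: norm_mult pos)
  then have "cmod ?r \<le> 1 - p 1" using p2 by simp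
  moreover have "symbol \<xi> = of_real (p 1) + ?r" unfolding symbol_def s by simp
  moreover have "cmod (of_real (p 1)) = p 1" using pos by simp
  ultimately show ?thesis using norm_diff_ineq[of "of_real (p 1)" ?r] by simp
qed

text \<open>The deviation of the symbol from 1 is the \<open>p\<close>-average of the deviations of
  its exponentials; bounding each \<open>p l\<close> by 1 leaves an estimate free of the
  weights.\<close>

lemma norm_symbol_ge_near_integers:
  assumes "\<And>l. l \<in> {1..m} \<Longrightarrow> \<bar>\<xi> \<bullet> (a l - a 1) - of_int (N l)\<bar> \<le> \<epsilon> l"
  shows "1 - (\<Sum>l=1..m. 2 * pi * \<epsilon> l) \<le> cmod (symbol \<xi>)"
proof -
  have p1: "(\<Sum>l=1..m. p l) = 1" and pos: "\<And>l. l \<in> {1..m} \<Longrightarrow> 0 \<le> p l"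
    using p by (auto simp: probability_vector_def)
  have ple: "p l \<le> 1" if "l \<in> {1..m}" for l
    using member_le_sum[OF that, of p] pos p1 by auto
  have "symbol \<xi> - 1 = symbol \<xi> - of_real (\<Sum>l=1..m. p l)" by (simp only: p1 of_real_1)
  also have "\<dots> = (\<Sum>l=1..m. of_real (p l) * (unit_exp (\<xi> \<bullet> (a l - a 1)) - 1))"
    by (simp add: symbol_def right_diff_distrib sum_subtractf)
  finally have "cmod (symbol \<xi> - 1) \<le> (\<Sum>l=1..m. cmod (of_real (p l) * (unit_exp (\<xi> \<bullet> (a l - a 1)) - 1)))"
    by (simp only: norm_sum)
  also have "\<dots> \<le> (\<Sum>l=1..m. 2 * pi * \<epsilon> l)"
  proof (rule sum_mono)
    fix l assume l: "l \<in> {1..m}"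
    have "cmod (unit_exp (\<xi> \<bullet> (a l - a 1)) - 1) \<le> 2 * pi * \<bar>\<xi> \<bullet> (a l - a 1) - of_int (N l)\<bar>"
      unfolding unit_exp_def by (rule norm_exp_near_integer)
    also have "\<dots> \<le> 2 * pi * \<epsilon> l" using assms[OF l] by (intro mult_left_mono) auto
    finally have le: "cmod (unit_exp (\<xi> \<bullet> (a l - a 1)) - 1) \<le> 2 * pi * \<epsilon> l" .
    have "p l * cmod (unit_exp (\<xi> \<bullet> (a l - a 1)) - 1) \<le> 1 * cmod (unit_exp (\<xi> \<bullet> (a l - a 1)) - 1)"
      using ple[OF l] by (rule mult_right_mono) simp
    with le show "cmod (of_real (p l) * (unit_exp (\<xi> \<bullet> (a l - a 1)) - 1)) \<le> 2 * pi * \<epsilon> l"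
      using pos[OF l] by (simp add: norm_mult)
  qed
  finally show ?thesis using norm_triangle_ineq2[of 1 "symbol \<xi>"] by (simp add: norm_minus_commute)
qed

text \<open>The factors in the product formula are bounded below by \<open>2 p\<^sub>1 - 1 > 0\<close>, so a zero at \<open>\<xi>\<close>
  would spread to \<open>(A\<^sup>\<top>)\<^sup>n \<xi> \<rightarrow> 0\<close>, where the transform tends to 1.\<close>

lemma fourier_nonzero:
  assumes "1 \<le> m" "1 / 2 < p 1"
  shows "fourier_transform \<mu> \<xi> \<noteq> 0"
proof
  assume z: "fourier_transform \<mu> \<xi> = 0"
  let ?\<xi> = "\<lambda>n. (((*v) (transpose A)) ^^ n) \<xi>"
  have s: "sets \<mu> = sets borel" and "prob_space \<mu>"
    using self_affine_self_affine_measure by (auto simp: self_affine_def borel_probability_measure_def)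
  interpret prob_space \<mu> by fact
  have zn: "fourier_transform \<mu> (?\<xi> n) = 0" for n
  proof (induction n)
    case (Suc n)
    have "cmod (symbol (?\<xi> n)) \<noteq> 0" using norm_symbol_ge[OF assms(1), of "?\<xi> n"] assms(2) by linarith
    then have "cmod (fourier_transform \<mu> (transpose A *v ?\<xi> n)) = 0"
      using fourier_self_affine[of "?\<xi> n"] Suc by (metis mult_eq_0_iff norm_zero)
    then show ?case by (simp only: funpow.simps o_apply norm_eq_zero)
  qed (simp add: z)
  have "(\<lambda>n. LINT x|\<mu>. unit_exp (?\<xi> n \<bullet> x)) \<longlonglongrightarrow> (LINT x|\<mu>. 1)"
  proof (rule integral_dominated_convergence[where w = "\<lambda>_. 1"])
    show "AE x in \<mu>. (\<lambda>n. unit_exp (?\<xi> n \<bullet> x)) \<longlonglongrightarrow> 1"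
    proof (rule AE_I2)
      fix x
      \<comment> \<open>Summability is available for orbits of \<open>A\<close>, not of its
        transpose, so the iterates are moved onto \<open>x\<close>.\<close>
      have "(\<lambda>n. (((*v) A) ^^ n) x) \<longlonglongrightarrow> 0"
        by (rule tendsto_norm_zero_cancel[OF summable_LIMSEQ_zero[OF iterates_summable]])
      then have "(\<lambda>n. ?\<xi> n \<bullet> x) \<longlonglongrightarrow> \<xi> \<bullet> 0"
        unfolding inner_matrix_iterates by (intro tendsto_inner tendsto_const)
      then have "(\<lambda>n. unit_exp (?\<xi> n \<bullet> x)) \<longlonglongrightarrow> unit_exp (\<xi> \<bullet> 0)"
        by (rule tendsto_unit_exp)
      then show "(\<lambda>n. unit_exp (?\<xi> n \<bullet> x)) \<longlonglongrightarrow> 1" by (simp only: inner_zero_right unit_exp_0)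
    qed
    show "(\<lambda>x. unit_exp (?\<xi> n \<bullet> x)) \<in> borel_measurable \<mu>" for n
      unfolding measurable_cong_sets[OF s refl] by measurable
  qed simp_all
  moreover have "(LINT x|\<mu>. unit_exp (?\<xi> n \<bullet> x)) = 0" for n
    using zn[of n] by (simp add: fourier_transform_def unit_exp_def)
  ultimately have "(\<lambda>n. 0 :: complex) \<longlonglongrightarrow> 1" by (simp add: prob_space)
  then show False by (simp add: LIMSEQ_const_iff)
qed

lemma not_rajchman_if_near_integers:
  assumes m: "1 \<le> m" and p1: "1 / 2 < p 1"
    and \<xi>: "\<xi> 0 \<noteq> 0" "\<And>n. transpose A *v \<xi> (Suc n) = \<xi> n"
    and near: "\<And>l. l \<in> {1..m} \<Longrightarrow>
      \<exists>\<epsilon> N. summable \<epsilon> \<and> (\<forall>n. \<bar>\<xi> n \<bullet> (a l - a 1) - of_int (N n)\<bar> \<le> \<epsilon> n)"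
  shows "\<not> rajchman \<mu>"
proof
  assume R: "rajchman \<mu>"
  define u where "u n = cmod (fourier_transform \<mu> (\<xi> n))" for n
  have "\<forall>l\<in>{1..m}. \<exists>\<epsilon>N. summable (fst \<epsilon>N) \<and>
      (\<forall>n. \<bar>\<xi> n \<bullet> (a l - a 1) - of_int (snd \<epsilon>N n)\<bar> \<le> fst \<epsilon>N n)"
    using near by fastforce
  from bchoice[OF this] obtain F where F': "\<forall>l\<in>{1..m}. summable (fst (F l)) \<and>
      (\<forall>n. \<bar>\<xi> n \<bullet> (a l - a 1) - of_int (snd (F l) n)\<bar> \<le> fst (F l) n)"
    by (elim exE) (rule that; assumption)
  have F: "summable (fst (F l))" "\<bar>\<xi> n \<bullet> (a l - a 1) - of_int (snd (F l) n)\<bar> \<le> fst (F l) n"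
    if "l \<in> {1..m}" for l n
    using bspec[OF F' that] by auto
  define \<delta> where "\<delta> n = (\<Sum>l=1..m. 2 * pi * fst (F l) n)" for n
  have "\<not> u \<longlonglongrightarrow> 0"
  proof (rule not_tendsto_0_if_summable_loss)
    show "0 < u n" for n using fourier_nonzero[OF m p1] by (simp add: u_def)
    \<comment> \<open>The factor linking \<open>\<xi> n\<close> to \<open>\<xi> (Suc n)\<close> is
      the symbol at \<open>\<xi> (Suc n)\<close>, hence the shift.\<close>
    show "summable (\<lambda>n. \<delta> (Suc n))"
      unfolding \<delta>_def using F(1)
      by (intro summable_sum summable_mult) (simp add: summable_Suc_iff)
    show "0 \<le> \<delta> (Suc n)" for n
      unfolding \<delta>_def
    proof (intro sum_nonneg mult_nonneg_nonneg)
      fix l assume "l \<in> {1..m}"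
      from F(2)[OF this, of "Suc n"] show "0 \<le> fst (F l) (Suc n)" by linarith
    qed auto
    show "(1 - \<delta> (Suc n)) * u n \<le> u (Suc n)" for n
    proof -
      have "1 - \<delta> (Suc n) \<le> cmod (symbol (\<xi> (Suc n)))"
        unfolding \<delta>_def by (rule norm_symbol_ge_near_integers) (rule F(2))
      then have "(1 - \<delta> (Suc n)) * u n \<le> cmod (symbol (\<xi> (Suc n))) * u n"
        by (rule mult_right_mono) (simp add: u_def)
      then show ?thesis using fourier_self_affine[of "\<xi> (Suc n)"] by (simp only: u_def \<xi>(2))
    qed
  qed
  \<comment> \<open>The pairing of \<open>\<xi> n\<close> with \<open>A^n (\<xi> 0)\<close> is
    constantly the squared norm of \<open>\<xi> 0\<close>. As the second vector tends to 0,
    Cauchy-Schwarz forces the first to be unbounded.\<close>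
  moreover have "filterlim \<xi> at_infinity sequentially"
    unfolding filterlim_at_infinity[OF order_refl]
  proof (intro allI impI)
    fix r :: real assume r: "0 < r"
    have \<xi>n: "(((*v) (transpose A)) ^^ n) (\<xi> n) = \<xi> 0" for n
    proof (induction n)
      case (Suc n)
      then show ?case by (simp only: funpow_Suc_right o_apply \<xi>(2))
    qed simp
    have "(\<lambda>n. norm ((((*v) A) ^^ n) (\<xi> 0))) \<longlonglongrightarrow> 0"
      by (rule summable_LIMSEQ_zero[OF iterates_summable])
    moreover have "0 < (norm (\<xi> 0))\<^sup>2 / r" using r \<xi>(1) by simp
    ultimately have "\<forall>\<^sub>F n in sequentially. norm ((((*v) A) ^^ n) (\<xi> 0)) < (norm (\<xi> 0))\<^sup>2 / r"
      by (rule order_tendstoD(2))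
    then show "\<forall>\<^sub>F n in sequentially. r \<le> norm (\<xi> n)"
    proof (rule eventually_mono)
      fix n assume lt: "norm ((((*v) A) ^^ n) (\<xi> 0)) < (norm (\<xi> 0))\<^sup>2 / r"
      show "r \<le> norm (\<xi> n)"
      proof (rule ccontr)
        assume "\<not> r \<le> norm (\<xi> n)"
        have "(norm (\<xi> 0))\<^sup>2 = \<xi> n \<bullet> ((((*v) A) ^^ n) (\<xi> 0))"
          using inner_matrix_iterates[where A = A and n = n and x = "\<xi> n" and y = "\<xi> 0"]
          by (simp only: \<xi>n power2_norm_eq_inner)
        also have "\<dots> \<le> norm (\<xi> n) * norm ((((*v) A) ^^ n) (\<xi> 0))" by (rule norm_cauchy_schwarz)
        also have "\<dots> \<le> r * norm ((((*v) A) ^^ n) (\<xi> 0))"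
          using \<open>\<not> r \<le> norm (\<xi> n)\<close> by (intro mult_right_mono) auto
        also have "\<dots> < (norm (\<xi> 0))\<^sup>2" using lt r by (simp add: field_simps)
        finally show False by simp
      qed
    qed
  qed
  then have "u \<longlonglongrightarrow> 0"
    unfolding u_def using R[unfolded rajchman_def] by (rule filterlim_compose[rotated])
  ultimately show False by simp
qed

end

theorem theorem1p11:
  fixes m :: nat and A :: "real ^ 'd ^ 'd" and a :: "nat \<Rightarrow> real ^ 'd"
  assumes "generalized_pisot_ifs m A a"
    and "affinely_irreducible m A a"
  shows "\<exists>p :: nat \<Rightarrow> real. probability_vector m p \<and> (\<forall>l\<in>{1..m}. 0 < p l) \<and>
           \<not> rajchman (self_affine_measure m A a p)"
proof -
  have m: "1 \<le> m" and rad: "real_mat_spectral_radius A < 1"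
    using assms(1) by (auto simp: generalized_pisot_ifs_def homogeneous_affine_ifs_def)
  obtain \<xi> where \<xi>: "\<xi> 0 \<noteq> 0" "\<And>n. transpose A *v \<xi> (Suc n) = \<xi> n"
    "\<And>l. l \<in> {1..m} \<Longrightarrow> \<exists>\<epsilon> N. summable \<epsilon> \<and> (\<forall>n. \<bar>\<xi> n \<bullet> (a l - a 1) - of_int (N n)\<bar> \<le> \<epsilon> n)"
    using pisot_frequencies[OF assms] by (elim exE conjE) (rule that, assumption, erule spec, erule bspec)
  \<comment> \<open>Half the uniform distribution plus half a point mass at 1: every weight is
    positive and \<open>p 1\<close> exceeds 1/2 for every \<open>m\<close>, including
    \<open>m = 1\<close>.\<close>
  define p :: "nat \<Rightarrow> real" where "p l = (if l = 1 then (real m + 1) / (2 * real m) else 1 / (2 * real m))" for l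
  have s: "{1..m} = insert 1 {2..m}" using m by auto
  have "(\<Sum>l=1..m. p l) = p 1 + (\<Sum>l=2..m. 1 / (2 * real m))"
    unfolding s by (simp add: p_def)
  also have "\<dots> = 1" using m by (simp add: p_def field_simps of_nat_diff)
  finally have sum: "(\<Sum>l=1..m. p l) = 1" .
  have pos: "0 < p l" for l using m by (simp add: p_def)
  have pv: "probability_vector m p" unfolding probability_vector_def using sum pos less_imp_le by blast
  interpret iterated_random_maps m A a p
    by unfold_locales (fact pv, rule summable_norm_iterates_spectral_radius[OF rad])
  have "1 / 2 < p 1" using m by (simp add: p_def field_simps)
  then have "\<not> rajchman (self_affine_measure m A a p)"
    by (rule not_rajchman_if_near_integers[OF m _ \<xi>])
  then show ?thesis using pv pos by blast
qed

end
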